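(* Let $0\le\beta<1$. Let $f$ be a bounded integrable function on $[0,\infty)$ that has a second derivative at a point $x\in[0,\infty)$. Then $$\lim_{n\to\infty}n\left[D_n^{\beta}(f,x)-f(x)\right]=\frac{1}{1-\beta}f'(x)+\frac{x}{1-\beta}f''(x).$$
   Context: For $0\le\beta<1$, a positive integer $n$, an integer $k\ge 0$ and $x\in[0,\infty)$, the basis function is $$L_{n,k}^{(\beta)}(x)=\frac{nx(nx+k\beta)^{k-1}}{k!}e^{-(nx+k\beta)}$$ (for $k=0$ this is $e^{-nx}$). The operators $D_n^{\beta}$ are $$D_n^{\beta}(f,x)=\sum_{k=0}^{\infty}\left(\int_0^\infty L_{n,k}^{(\beta)}(t)\,dt\right)^{-1}L_{n,k}^{(\beta)}(x)\int_0^\infty L_{n,k}^{(\beta)}(t)f(t)\,dt .$$ The parameter $\beta$ is fixed (it does not depend on $n$).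
   Formalization: At x = 0 the formal theorem additionally assumes β = 0 or f'(0) = 0, since there the limit is f'(0), not f'(0)/(1−β); e.g. β = 1/2, f(t) = t e^{-t} gives limit 1 instead of 2. *)

theory Defs
  imports "HOL-Analysis.Analysis"
begin

text \<open>
  The exponent \<open>k - 1\<close> is truncated on \<^typ>\<open>nat\<close>, so \<open>k = 0\<close> is a separate case. It agrees with
  the general formula for \<open>n * x > 0\<close> and extends it continuously to \<open>x = 0\<close>.
\<close>

definition jain_basis :: "real \<Rightarrow> nat \<Rightarrow> nat \<Rightarrow> real \<Rightarrow> real" where
  "jain_basis \<beta> n k x =
     (if k = 0 then exp (- (real n * x))
      else real n * x * (real n * x + real k * \<beta>) ^ (k - 1) / fact k
             * exp (- (real n * x + real k * \<beta>)))"

definition jain_durrmeyer :: "real \<Rightarrow> nat \<Rightarrow> (real \<Rightarrow> real) \<Rightarrow> real \<Rightarrow> real" where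
  "jain_durrmeyer \<beta> n f x =
     (\<Sum>k. inverse (LINT t:{0..}|lebesgue. jain_basis \<beta> n k t)
            * jain_basis \<beta> n k x
            * (LINT t:{0..}|lebesgue. jain_basis \<beta> n k t * f t))"

text \<open>
  At \<open>x = 0\<close> only the term \<open>k = 0\<close> survives, and the operator does not depend on \<open>\<beta>\<close>. Hence
  \<open>n * (jain_durrmeyer \<beta> n f 0 - f 0)\<close> tends to \<open>f' 0\<close>, which is
  \<open>f' 0 / (1 - \<beta>)\<close> only if \<open>\<beta> = 0\<close> or \<open>f' 0 = 0\<close>.
\<close>

lemma jain_basis_at_0: "jain_basis \<beta> n k 0 = (if k = 0 then 1 else 0)"
  by (simp add: jain_basis_def)

lemma jain_durrmeyer_at_0:
  "jain_durrmeyer \<beta> n f 0 =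
     inverse (LINT t:{0..}|lebesgue. exp (- (real n * t)))
       * (LINT t:{0..}|lebesgue. exp (- (real n * t)) * f t)"
proof -
  have "jain_durrmeyer \<beta> n f 0 =
     (\<Sum>k\<in>{0}. inverse (LINT t:{0..}|lebesgue. jain_basis \<beta> n k t)
            * jain_basis \<beta> n k 0
            * (LINT t:{0..}|lebesgue. jain_basis \<beta> n k t * f t))"
    unfolding jain_durrmeyer_def
    by (rule suminf_finite) (auto simp: jain_basis_at_0)
  then show ?thesis
    by (simp add: jain_basis_def)
qed

end

theory Submission
  imports Defs
begin

text \<open>
  The numbers \<open>P a k = jain_basis \<beta> 1 k a\<close>, where \<open>a = n x\<close>, form the generalized Poisson
  distribution in \<open>k\<close>; normalised, they are also the densities in \<open>s = n t\<close> that the operator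
  averages against. So \<open>jain_durrmeyer\<close> is the mean of \<open>f (s / n)\<close> for a two-step random experiment:
  choose \<open>k\<close>, then \<open>s\<close>. By Taylor's formula it suffices to find the first, second and fourth moments
  of \<open>s - a\<close>, which is the sum of \<open>k (1 - \<beta>) - a\<close> and \<open>s - k (1 - \<beta>)\<close>.

  For the first step, let \<open>Q a k\<close> be the Poisson-like weight \<open>(a + k \<beta>) ^ k / k! exp (- a - k \<beta>)\<close>.
  The two identities \<open>P a (k + 1) = Q a (k + 1) - \<beta> Q (a + \<beta>) k\<close> and
  \<open>(k + 1) P a (k + 1) = a Q (a + \<beta>) k\<close> turn moments of \<open>P\<close> into moments of \<open>Q\<close> of lower order, and
  give functional equations \<open>h a = c0 + c1 a + \<beta> h (a + \<beta>)\<close> for the latter, whose only solution of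
  moderate growth is affine. For the second step, integration by parts gives recursions for the
  moments up to boundary terms that decay exponentially in \<open>k\<close>.
\<close>

subsection \<open>Exponential bounds and sequences of polynomial growth\<close>

text \<open>The two steps enter the limit differently. The mean of \<open>k (1 - \<beta>)\<close> is
  exactly \<open>a\<close>, while the mean of \<open>s\<close> given \<open>k\<close> exceeds
  \<open>k (1 - \<beta>)\<close> by a quantity tending to \<open>1 / (1 - \<beta>)\<close>; so the
  whole drift arises in the second step. Both steps contribute \<open>a / (1 - \<beta>)\<close> to
  the leading second moment: the first directly, the second as the mean of \<open>k\<close>. The
  drift needs \<open>k\<close> to be large. At \<open>x = 0\<close> all weight stays at
  \<open>k = 0\<close>, where \<open>s\<close> has mean 1, and this case is treated apart. The
  fourth moment has to be \<open>o(n ^ 3)\<close>, so bounding \<open>(s - a) ^ 4\<close> by powers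
  of \<open>s\<close> and \<open>a\<close> is useless; exact recursions are used because the leading
  coefficients cancel in them. That the weights \<open>P\<close> sum to 1, classically an identity
  of Abel and Lagrange type, is derived from a delay differential equation in
  \<open>a\<close>.\<close>

lemma power_divide_fact_le_exp:
  fixes x :: real
  assumes "0 \<le> x"
  shows "x ^ k / fact k \<le> exp x"
proof -
  have s: "(\<lambda>n. x ^ n / fact n) sums exp x"
    using exp_converges[of x] by (simp add: divide_inverse mult.commute)
  have "sum (\<lambda>n. x ^ n / fact n) {k} \<le> (\<Sum>n. x ^ n / fact n)"
    by (rule sum_le_suminf) (use assms s in \<open>auto simp: sums_iff\<close>)
  also have "\<dots> = exp x" using s by (simp add: sums_iff)
  finally have "sum (\<lambda>n. x ^ n / fact n) {k} \<le> exp x" .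
  then show ?thesis by simp
qed

lemma power_le_exp:
  fixes x d :: real
  assumes "0 \<le> x" and "0 < d"
  shows "x ^ k \<le> fact k / d ^ k * exp (d * x)"
  using power_divide_fact_le_exp[of "d * x" k] assms
  by (simp add: power_mult_distrib field_simps)

text \<open>A side condition that survives sums, products and index shifts, so every sequence
  averaged below meets it easily; the exponential tail of the weights makes it sufficient for
  summability.\<close>

definition poly_bounded :: "(nat \<Rightarrow> real) \<Rightarrow> bool" where
  "poly_bounded \<phi> \<longleftrightarrow> (\<exists>C j. 0 \<le> C \<and> (\<forall>k. \<bar>\<phi> k\<bar> \<le> C * (real k + 1) ^ j))"

lemma poly_bounded_const [intro, simp]: "poly_bounded (\<lambda>k. c)"
  unfolding poly_bounded_def by (rule exI[of _ "\<bar>c\<bar>"], rule exI[of _ 0]) auto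

lemma poly_bounded_of_nat [intro, simp]: "poly_bounded real"
  unfolding poly_bounded_def by (rule exI[of _ 1], rule exI[of _ 1]) auto

lemma poly_bounded_add [intro, simp]:
  assumes "poly_bounded f" and "poly_bounded g"
  shows "poly_bounded (\<lambda>k. f k + g k)"
proof -
  from assms obtain C i D j where C: "0 \<le> C" "\<And>k. \<bar>f k\<bar> \<le> C * (real k + 1) ^ i"
    and D: "0 \<le> D" "\<And>k. \<bar>g k\<bar> \<le> D * (real k + 1) ^ j"
    unfolding poly_bounded_def by blast
  have "\<bar>f k + g k\<bar> \<le> (C + D) * (real k + 1) ^ (i + j)" for k
  proof -
    have "\<bar>f k\<bar> \<le> C * (real k + 1) ^ (i + j)"
      by (rule order_trans[OF C(2)]) (intro mult_left_mono power_increasing C; simp)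
    moreover have "\<bar>g k\<bar> \<le> D * (real k + 1) ^ (i + j)"
      by (rule order_trans[OF D(2)]) (intro mult_left_mono power_increasing D; simp)
    ultimately show ?thesis by (simp add: distrib_right)
  qed
  then show ?thesis
    unfolding poly_bounded_def using C(1) D(1)
    by (intro exI[of _ "C + D"] exI[of _ "i + j"]) auto
qed

lemma poly_bounded_mult [intro, simp]:
  assumes "poly_bounded f" and "poly_bounded g"
  shows "poly_bounded (\<lambda>k. f k * g k)"
proof -
  from assms obtain C i D j where C: "0 \<le> C" "\<And>k. \<bar>f k\<bar> \<le> C * (real k + 1) ^ i"
    and D: "0 \<le> D" "\<And>k. \<bar>g k\<bar> \<le> D * (real k + 1) ^ j"
    unfolding poly_bounded_def by blast
  have "\<bar>f k * g k\<bar> \<le> (C * D) * (real k + 1) ^ (i + j)" for k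
    using mult_mono[OF C(2)[of k] D(2)[of k]] C(1)
    by (simp add: abs_mult power_add mult_ac)
  then show ?thesis
    unfolding poly_bounded_def using C(1) D(1)
    by (intro exI[of _ "C * D"] exI[of _ "i + j"]) auto
qed

lemma poly_bounded_minus [intro, simp]: "poly_bounded f \<Longrightarrow> poly_bounded (\<lambda>k. - f k)"
  by (simp add: poly_bounded_def)

lemma poly_bounded_diff [intro, simp]:
  "poly_bounded f \<Longrightarrow> poly_bounded g \<Longrightarrow> poly_bounded (\<lambda>k. f k - g k)"
  using poly_bounded_add[of f "\<lambda>k. - g k"] by (simp add: poly_bounded_minus)

lemma poly_bounded_power [intro, simp]: "poly_bounded f \<Longrightarrow> poly_bounded (\<lambda>k. f k ^ m)"
  by (induction m) auto

lemma poly_bounded_Suc: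
  assumes "poly_bounded f"
  shows "poly_bounded (\<lambda>k. f (Suc k))"
proof -
  from assms obtain C i where C: "0 \<le> C" "\<And>k. \<bar>f k\<bar> \<le> C * (real k + 1) ^ i"
    unfolding poly_bounded_def by blast
  have "\<bar>f (Suc k)\<bar> \<le> (C * 2 ^ i) * (real k + 1) ^ i" for k
  proof -
    have "\<bar>f (Suc k)\<bar> \<le> C * (real (Suc k) + 1) ^ i" by (rule C(2))
    also have "\<dots> \<le> C * (2 * (real k + 1)) ^ i"
      by (intro mult_left_mono power_mono C(1)) auto
    finally show ?thesis by (simp only: power_mult_distrib mult_ac)
  qed
  then show ?thesis
    unfolding poly_bounded_def using C(1)
    by (intro exI[of _ "C * 2 ^ i"] exI[of _ i]) auto
qed

lemma tendsto_imp_abs_bounded: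
  fixes f :: "nat \<Rightarrow> real"
  assumes "f \<longlonglongrightarrow> L"
  obtains G where "\<And>k. \<bar>f k\<bar> \<le> G"
  using convergent_imp_Bseq[OF convergentI[OF assms]] by (auto simp: Bseq_def)

lemma poly_bounded_convergent:
  assumes "f \<longlonglongrightarrow> (L::real)"
  shows "poly_bounded f"
proof -
  obtain K where "\<And>k. \<bar>f k\<bar> \<le> K"
    using tendsto_imp_abs_bounded[OF assms] by blast
  then show ?thesis
    unfolding poly_bounded_def
    by (intro exI[of _ "\<bar>K\<bar>"] exI[of _ 0]) (auto intro: order_trans[OF _ abs_ge_self])
qed

lemma poly_bounded_le:
  assumes "poly_bounded g" and "\<And>k. \<bar>f k\<bar> \<le> g k"
  shows "poly_bounded f"
proof -
  from assms(1) obtain C j where C: "0 \<le> C" "\<And>k. \<bar>g k\<bar> \<le> C * (real k + 1) ^ j"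
    unfolding poly_bounded_def by blast
  have "\<bar>f k\<bar> \<le> C * (real k + 1) ^ j" for k using assms(2)[of k] C(2)[of k] by linarith
  then show ?thesis unfolding poly_bounded_def using C(1) by blast
qed

subsection \<open>Generalized Poisson weights\<close>

text \<open>The Poisson probability of \<open>k\<close> for a mean \<open>a + k \<beta>\<close> that
  itself moves with \<open>k\<close>. As weights in \<open>k\<close> these do not sum to 1; for
  \<open>0 \<le> \<beta> < 1\<close> and \<open>a \<ge> 0\<close> the sum turns out to be
  \<open>1 / (1 - \<beta>)\<close>.\<close>

definition poisson_weight :: "real \<Rightarrow> real \<Rightarrow> nat \<Rightarrow> real" where
  "poisson_weight \<beta> a k = (a + real k * \<beta>) ^ k / fact k * exp (- (a + real k * \<beta>))"

definition gen_poisson :: "real \<Rightarrow> real \<Rightarrow> nat \<Rightarrow> real" where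
  "gen_poisson \<beta> a k = jain_basis \<beta> 1 k a"

lemma gen_poisson_0: "gen_poisson \<beta> a 0 = exp (- a)"
  by (simp add: gen_poisson_def jain_basis_def)

lemma gen_poisson_Suc:
  "gen_poisson \<beta> a (Suc k) =
     a * (a + real (Suc k) * \<beta>) ^ k / fact (Suc k) * exp (- (a + real (Suc k) * \<beta>))"
  by (simp add: gen_poisson_def jain_basis_def)

lemma jain_basis_eq_gen_poisson: "jain_basis \<beta> n k x = gen_poisson \<beta> (real n * x) k"
  by (simp add: gen_poisson_def jain_basis_def)

text \<open>With \<open>u = a + (k + 1) \<beta>\<close>, which is also the mean in
  \<open>poisson_weight \<beta> (a + \<beta>) k\<close>, the factor \<open>a\<close> is
  \<open>u - (k + 1) \<beta>\<close>: the first part raises the exponent of \<open>u\<close>, the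
  second cancels in the factorial.\<close>

lemma gen_poisson_Suc_eq_poisson:
  "gen_poisson \<beta> a (Suc k) = poisson_weight \<beta> a (Suc k) - \<beta> * poisson_weight \<beta> (a + \<beta>) k"
proof -
  have e: "a + \<beta> + real k * \<beta> = a + real (Suc k) * \<beta>" by (simp add: algebra_simps)
  define u where "u = a + real (Suc k) * \<beta>"
  have a: "a = u - real (Suc k) * \<beta>" by (simp add: u_def)
  have f: "fact (Suc k) = real (Suc k) * fact k" by simp
  show ?thesis
    unfolding gen_poisson_Suc poisson_weight_def e u_def[symmetric] f
    by (subst a) (simp add: field_simps del: of_nat_Suc)
qed

lemma Suc_mult_gen_poisson_Suc:
  "real (Suc k) * gen_poisson \<beta> a (Suc k) = a * poisson_weight \<beta> (a + \<beta>) k"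
proof -
  have e: "a + \<beta> + real k * \<beta> = a + real (Suc k) * \<beta>" by (simp add: algebra_simps)
  have f: "fact (Suc k) = real (Suc k) * fact k" by simp
  show ?thesis
    unfolding gen_poisson_Suc poisson_weight_def e f
    by (simp add: field_simps del: of_nat_Suc)
qed

lemma gen_poisson_has_derivative_0:
  "((\<lambda>a. gen_poisson \<beta> a 0) has_real_derivative - gen_poisson \<beta> a 0) (at a within S)"
  unfolding gen_poisson_0 by (auto intro!: derivative_eq_intros)

text \<open>For \<open>\<beta> = 0\<close> this is the forward equation of the Poisson process.
  Summed over \<open>k\<close> it yields a delay equation for the total mass.\<close>

lemma gen_poisson_has_derivative_Suc:
  "((\<lambda>a. gen_poisson \<beta> a (Suc k)) has_real_derivative
      gen_poisson \<beta> (a + \<beta>) k - gen_poisson \<beta> a (Suc k)) (at a within S)"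
proof (cases k)
  case 0
  show ?thesis
    unfolding 0 gen_poisson_Suc gen_poisson_0
    by (auto intro!: derivative_eq_intros simp: algebra_simps minus_diff_commute[of \<beta> a])
next
  case (Suc m)
  define c where "c = real (Suc k) * \<beta>"
  have e: "a + \<beta> + real (Suc m) * \<beta> = a + c" by (simp add: c_def Suc algebra_simps)
  \<comment> \<open>Collects the two terms of the product rule into one multiple of
    \<open>Suc k\<close>, which cancels against the factorial.\<close>
  have c: "(a + \<beta>) * real (Suc k) = a + c + real k * a"
    by (simp add: c_def Suc algebra_simps)
  have f: "fact (Suc k) = real (Suc k) * fact k" by simp
  have "((\<lambda>a. a * (a + c) ^ k / fact (Suc k) * exp (- (a + c))) has_real_derivative
         ((a + c) ^ k + a * (real k * (a + c) ^ m)) / fact (Suc k) * exp (- (a + c))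
           - a * (a + c) ^ k / fact (Suc k) * exp (- (a + c))) (at a within S)"
    by (rule derivative_eq_intros refl | simp add: Suc mult_ac)+
  moreover have "((a + c) ^ k + a * (real k * (a + c) ^ m)) / fact (Suc k)
       = (a + \<beta>) * (a + c) ^ m / fact k"
  proof -
    have "(a + c) ^ k + a * (real k * (a + c) ^ m) = (a + c + real k * a) * (a + c) ^ m"
      by (simp add: Suc algebra_simps)
    also have "\<dots> = real (Suc k) * ((a + \<beta>) * (a + c) ^ m)"
      unfolding c[symmetric] by (simp only: mult_ac)
    finally show ?thesis unfolding f by (simp del: of_nat_Suc)
  qed
  moreover have "gen_poisson \<beta> (a + \<beta>) k = (a + \<beta>) * (a + c) ^ m / fact k * exp (- (a + c))"
    unfolding Suc gen_poisson_Suc e ..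
  ultimately show ?thesis
    unfolding gen_poisson_Suc c_def[symmetric] by (simp only:)
qed

locale jain =
  fixes \<beta> :: real
  assumes \<beta>_nonneg: "0 \<le> \<beta>" and \<beta>_less_1: "\<beta> < 1"
begin

abbreviation P :: "real \<Rightarrow> nat \<Rightarrow> real" where "P a k \<equiv> gen_poisson \<beta> a k"
abbreviation Q :: "real \<Rightarrow> nat \<Rightarrow> real" where "Q a k \<equiv> poisson_weight \<beta> a k"

lemma P_nonneg: "0 \<le> a \<Longrightarrow> 0 \<le> P a k"
  using \<beta>_nonneg by (simp add: gen_poisson_def jain_basis_def)

lemma P_at_0: "P 0 = (\<lambda>k. if k \<in> {0} then 1 else 0)"
  by (rule ext) (auto simp: gen_poisson_def jain_basis_def)

lemma Q_nonneg: "0 \<le> a \<Longrightarrow> 0 \<le> Q a k"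
  using \<beta>_nonneg by (simp add: poisson_weight_def)

lemma P_le_Q: "0 \<le> a \<Longrightarrow> P a k \<le> Q a k"
  using \<beta>_nonneg Q_nonneg[of "a + \<beta>"]
  by (cases k) (auto simp: gen_poisson_Suc_eq_poisson gen_poisson_0 poisson_weight_def[of \<beta> a 0])

text \<open>Exponential tilting:
  \<open>u ^ k / k! \<le> exp ((1 + \<eta>) u) / (1 + \<eta>) ^ k\<close> at
  \<open>u = a + k \<beta>\<close> bounds \<open>Q a k\<close> by
  \<open>exp (\<eta> a) r ^ k\<close>. The condition \<open>\<beta> * (1 + \<eta>) < 1\<close> is
  exported because the growth condition in \<open>Q_tail\<close> rests on it.\<close>

lemma chernoff_rate:
  obtains \<eta> r where "0 < \<eta>" "0 < r" "r < 1" "\<beta> * (1 + \<eta>) < 1" "exp (\<eta> * \<beta>) = (1 + \<eta>) * r"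
proof
  \<comment> \<open>Then \<open>1 + \<eta> = 2 / (1 + \<beta>)\<close> and
    \<open>\<beta> (1 + \<eta>) = 2 \<beta> / (1 + \<beta>) < 1\<close>. The minimiser of
    \<open>r\<close> would be \<open>1 + \<eta> = 1 / \<beta>\<close>; this choice stays below it
    and makes sense at \<open>\<beta> = 0\<close>.\<close>
  define \<eta> where "\<eta> = (1 - \<beta>) / (1 + \<beta>)"
  define r where "r = exp (\<eta> * \<beta>) / (1 + \<eta>)"
  show \<eta>: "0 < \<eta>" using \<beta>_nonneg \<beta>_less_1 by (simp add: \<eta>_def)
  show "0 < r" using \<eta> by (simp add: r_def)
  show b: "\<beta> * (1 + \<eta>) < 1" using \<beta>_nonneg \<beta>_less_1 by (simp add: \<eta>_def field_simps)
  show "exp (\<eta> * \<beta>) = (1 + \<eta>) * r" using \<eta> by (simp add: r_def)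
  have "(1 + \<eta>) * (1 - \<eta> * \<beta>) = 1 + \<eta> * (1 - \<beta> * (1 + \<eta>))" by (simp add: algebra_simps)
  also have "\<dots> > 1" using \<eta> b by simp
  finally have 1: "1 < (1 + \<eta>) * (1 - \<eta> * \<beta>)" .
  then have 2: "0 < 1 - \<eta> * \<beta>" using \<eta> by (smt (verit) mult_nonneg_nonpos)
  have "1 - \<eta> * \<beta> \<le> exp (- (\<eta> * \<beta>))" using exp_ge_add_one_self[of "- (\<eta> * \<beta>)"] by simp
  then have "exp (\<eta> * \<beta>) * (1 - \<eta> * \<beta>) \<le> 1"
    by (simp add: exp_minus field_simps)
  then have "exp (\<eta> * \<beta>) * (1 - \<eta> * \<beta>) < (1 + \<eta>) * (1 - \<eta> * \<beta>)" using 1 by linarith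
  then have "exp (\<eta> * \<beta>) < 1 + \<eta>" using 2 by simp
  then show "r < 1" using \<eta> by (simp add: r_def)
qed

text \<open>
  The condition \<open>\<beta> * exp (\<mu> * \<beta>) < 1\<close> is what makes solutions of
  \<open>h a = c0 + c1 * a + \<beta> * h (a + \<beta>)\<close> with growth \<open>exp (\<mu> * a)\<close> unique.
\<close>
lemma Q_tail:
  obtains \<mu> \<rho> where "0 < \<mu>" "0 < \<rho>" "\<rho> < 1" "\<beta> * exp (\<mu> * \<beta>) < 1"
    "\<And>j. \<exists>C\<ge>0. \<forall>a\<ge>0. \<forall>k. (real k + 1 + a) ^ j * Q a k \<le> C * exp (\<mu> * a) * \<rho> ^ k"
proof -
  obtain \<eta> r where r: "0 < \<eta>" "0 < r" "r < 1" "\<beta> * (1 + \<eta>) < 1" "exp (\<eta> * \<beta>) = (1 + \<eta>) * r"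
    by (rule chernoff_rate)
  have Qr: "Q a k \<le> exp (\<eta> * a) * r ^ k" if "0 \<le> a" for a k
  proof -
    define u where "u = a + real k * \<beta>"
    have u: "0 \<le> u" using that \<beta>_nonneg by (simp add: u_def)
    have "((1 + \<eta>) * u) ^ k / fact k \<le> exp ((1 + \<eta>) * u)"
      using u r(1) by (intro power_divide_fact_le_exp) simp
    then have "(1 + \<eta>) ^ k * (u ^ k / fact k) \<le> exp ((1 + \<eta>) * u)"
      by (simp only: power_mult_distrib times_divide_eq_right)
    then have "u ^ k / fact k \<le> exp ((1 + \<eta>) * u) / (1 + \<eta>) ^ k"
      using r(1) by (subst pos_le_divide_eq) (simp_all only: zero_less_power mult_ac add_pos_pos zero_less_one)
    then have "Q a k \<le> exp ((1 + \<eta>) * u) / (1 + \<eta>) ^ k * exp (- u)"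
      unfolding poisson_weight_def u_def[symmetric] by (intro mult_right_mono) auto
    also have "\<dots> = exp (\<eta> * u) / (1 + \<eta>) ^ k"
      by (simp add: mult_exp_exp[symmetric] exp_minus algebra_simps exp_add)
    also have "exp (\<eta> * u) = exp (\<eta> * a) * exp (\<eta> * \<beta>) ^ k"
      by (simp add: u_def exp_of_nat_mult[symmetric] mult_exp_exp algebra_simps)
    also have "\<dots> / (1 + \<eta>) ^ k = exp (\<eta> * a) * r ^ k"
      using r(1) by (simp add: r(5) power_mult_distrib)
    finally show ?thesis .
  qed
  \<comment> \<open>Half of the decay is spent: \<open>r * exp \<delta>\<close> is the square root
    of \<open>r\<close>, and \<open>exp (\<delta> * (k + 1 + a))\<close> dominates every power
    \<open>(k + 1 + a) ^ j\<close>, so the rates do not depend on \<open>j\<close>.\<close>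
  define \<delta> where "\<delta> = - ln r / 2"
  have \<delta>: "0 < \<delta>" using r by (simp add: \<delta>_def)
  have rd: "r * exp \<delta> < 1"
  proof -
    have "r * exp \<delta> = exp (ln r / 2)"
      using r(2) mult_exp_exp[of "ln r" \<delta>] by (simp add: \<delta>_def)
    then show ?thesis using r by simp
  qed
  show ?thesis
  proof (rule that[of "\<eta> + \<delta>" "r * exp \<delta>"])
    show "0 < \<eta> + \<delta>" using r \<delta> by simp
    show "0 < r * exp \<delta>" using r by simp
    show "r * exp \<delta> < 1" by (rule rd)
    have "exp ((\<eta> + \<delta>) * \<beta>) = exp (\<eta> * \<beta>) * exp (\<delta> * \<beta>)" by (simp add: mult_exp_exp algebra_simps)
    also have "\<dots> \<le> exp (\<eta> * \<beta>) * exp \<delta>" using \<delta> \<beta>_less_1 by (intro mult_left_mono) auto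
    also have "\<dots> = (1 + \<eta>) * (r * exp \<delta>)" by (simp add: r(5))
    finally have "\<beta> * exp ((\<eta> + \<delta>) * \<beta>) \<le> \<beta> * ((1 + \<eta>) * (r * exp \<delta>))"
      using \<beta>_nonneg by (intro mult_left_mono)
    also have "\<dots> \<le> \<beta> * (1 + \<eta>)"
    proof -
      have "(\<beta> * (1 + \<eta>)) * (r * exp \<delta>) \<le> (\<beta> * (1 + \<eta>)) * 1"
        using \<beta>_nonneg r(1) rd by (intro mult_left_mono) auto
      then show ?thesis by (simp add: mult_ac)
    qed
    finally show "\<beta> * exp ((\<eta> + \<delta>) * \<beta>) < 1" using r(4) by linarith
    fix j
    define C where "C = fact j / \<delta> ^ j * exp \<delta>"
    have C: "0 \<le> C" using \<delta> by (simp add: C_def)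
    have "(real k + 1 + a) ^ j * Q a k \<le> C * exp ((\<eta> + \<delta>) * a) * (r * exp \<delta>) ^ k"
      if a: "0 \<le> a" for a k
    proof -
      have "(real k + 1 + a) ^ j * Q a k
          \<le> (fact j / \<delta> ^ j * exp (\<delta> * (real k + 1 + a))) * (exp (\<eta> * a) * r ^ k)"
        using a \<delta> Qr[OF a] Q_nonneg[OF a] by (intro mult_mono power_le_exp) auto
      also have "exp (\<delta> * (real k + 1 + a)) = exp \<delta> ^ k * exp \<delta> * exp (\<delta> * a)"
        by (simp add: exp_of_nat_mult[symmetric] mult_exp_exp algebra_simps)
      also have "fact j / \<delta> ^ j * (exp \<delta> ^ k * exp \<delta> * exp (\<delta> * a)) * (exp (\<eta> * a) * r ^ k)
          = C * (exp (\<eta> * a) * exp (\<delta> * a)) * (r * exp \<delta>) ^ k"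
        by (simp add: C_def power_mult_distrib mult_ac)
      also have "exp (\<eta> * a) * exp (\<delta> * a) = exp ((\<eta> + \<delta>) * a)"
        by (simp add: mult_exp_exp algebra_simps)
      finally show ?thesis .
    qed
    then show "\<exists>C\<ge>0. \<forall>a\<ge>0. \<forall>k. (real k + 1 + a) ^ j * Q a k
        \<le> C * exp ((\<eta> + \<delta>) * a) * (r * exp \<delta>) ^ k"
      using C by blast
  qed
qed

lemma summable_Q:
  assumes "poly_bounded \<phi>" and a: "0 \<le> a"
  shows "summable (\<lambda>k. \<phi> k * Q a k)"
proof -
  from assms obtain D j where D: "0 \<le> D" "\<And>k. \<bar>\<phi> k\<bar> \<le> D * (real k + 1) ^ j"
    unfolding poly_bounded_def by blast
  obtain \<mu> \<rho> where \<rho>: "0 < \<rho>" "\<rho> < 1"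
    and tail: "\<And>j. \<exists>C\<ge>0. \<forall>a\<ge>0. \<forall>k. (real k + 1 + a) ^ j * Q a k \<le> C * exp (\<mu> * a) * \<rho> ^ k"
    by (rule Q_tail) blast
  from tail[of j] obtain C where C: "0 \<le> C"
    "\<And>a k. 0 \<le> a \<Longrightarrow> (real k + 1 + a) ^ j * Q a k \<le> C * exp (\<mu> * a) * \<rho> ^ k" by blast
  show ?thesis
  proof (rule summable_comparison_test')
    show "summable (\<lambda>k. D * C * exp (\<mu> * a) * \<rho> ^ k)"
      using \<rho> by (intro summable_mult summable_geometric) auto
    fix k :: nat
    have "norm (\<phi> k * Q a k) = \<bar>\<phi> k\<bar> * Q a k" using Q_nonneg[OF a] by (simp add: abs_mult)
    also have "\<dots> \<le> (D * (real k + 1 + a) ^ j) * Q a k"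
    proof (intro mult_right_mono Q_nonneg a)
      have "D * (real k + 1) ^ j \<le> D * (real k + 1 + a) ^ j"
        using a D(1) by (intro mult_left_mono power_mono) auto
      then show "\<bar>\<phi> k\<bar> \<le> D * (real k + 1 + a) ^ j" using D(2)[of k] by linarith
    qed
    also have "\<dots> \<le> D * (C * exp (\<mu> * a) * \<rho> ^ k)"
      using mult_left_mono[OF C(2)[OF a, of k] D(1)] by (simp add: mult_ac)
    finally show "norm (\<phi> k * Q a k) \<le> D * C * exp (\<mu> * a) * \<rho> ^ k" by (simp add: mult_ac)
  qed
qed

lemma summable_P:
  assumes "poly_bounded \<phi>" and a: "0 \<le> a"
  shows "summable (\<lambda>k. \<phi> k * P a k)"
proof (rule summable_comparison_test')
  have "poly_bounded (\<lambda>k. \<bar>\<phi> k\<bar>)" using assms(1) by (simp add: poly_bounded_def)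
  then show "summable (\<lambda>k. \<bar>\<phi> k\<bar> * Q a k)" by (rule summable_Q[OF _ a])
  show "norm (\<phi> k * P a k) \<le> \<bar>\<phi> k\<bar> * Q a k" for k
    using P_nonneg[OF a] P_le_Q[OF a] by (auto simp: abs_mult intro: mult_left_mono)
qed

section \<open>Sums of sequences against the weights \<open>P\<close> and \<open>Q\<close>\<close>

definition EP :: "real \<Rightarrow> (nat \<Rightarrow> real) \<Rightarrow> real" where "EP a \<phi> = (\<Sum>k. \<phi> k * P a k)"
definition EQ :: "real \<Rightarrow> (nat \<Rightarrow> real) \<Rightarrow> real" where "EQ a \<phi> = (\<Sum>k. \<phi> k * Q a k)"

lemma EP_sums: "poly_bounded \<phi> \<Longrightarrow> 0 \<le> a \<Longrightarrow> (\<lambda>k. \<phi> k * P a k) sums EP a \<phi>"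
  unfolding EP_def by (intro summable_sums summable_P)

lemma EQ_sums: "poly_bounded \<phi> \<Longrightarrow> 0 \<le> a \<Longrightarrow> (\<lambda>k. \<phi> k * Q a k) sums EQ a \<phi>"
  unfolding EQ_def by (intro summable_sums summable_Q)

lemma EP_add:
  assumes "poly_bounded \<phi>" "poly_bounded \<psi>" "0 \<le> a"
  shows "EP a (\<lambda>k. \<phi> k + \<psi> k) = EP a \<phi> + EP a \<psi>"
  using sums_unique[OF sums_add[OF EP_sums[OF assms(1,3)] EP_sums[OF assms(2,3)]]]
  by (simp add: EP_def distrib_right)

lemma EP_cmult: 
  assumes "poly_bounded \<phi>" "0 \<le> a"
  shows "EP a (\<lambda>k. c * \<phi> k) = c * EP a \<phi>"
  using sums_unique[OF sums_mult[OF EP_sums[OF assms], of c]]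
  by (simp add: EP_def mult.assoc)

lemma EQ_add:
  assumes "poly_bounded \<phi>" "poly_bounded \<psi>" "0 \<le> a"
  shows "EQ a (\<lambda>k. \<phi> k + \<psi> k) = EQ a \<phi> + EQ a \<psi>"
  using sums_unique[OF sums_add[OF EQ_sums[OF assms(1,3)] EQ_sums[OF assms(2,3)]]]
  by (simp add: EQ_def distrib_right)

lemma EQ_cmult: 
  assumes "poly_bounded \<phi>" "0 \<le> a"
  shows "EQ a (\<lambda>k. c * \<phi> k) = c * EQ a \<phi>"
  using sums_unique[OF sums_mult[OF EQ_sums[OF assms], of c]]
  by (simp add: EQ_def mult.assoc)

lemma EP_mono:
  assumes "poly_bounded \<phi>" "poly_bounded \<psi>" "0 \<le> a" "\<And>k. \<phi> k \<le> \<psi> k"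
  shows "EP a \<phi> \<le> EP a \<psi>"
  unfolding EP_def using assms
  by (intro suminf_le summable_P mult_right_mono P_nonneg) auto

text \<open>The identity \<open>gen_poisson_Suc_eq_poisson\<close> summed over \<open>k\<close>; the
  terms at 0 agree. The \<open>Q\<close>-sum reappears at \<open>a + \<beta>\<close>, which is the
  source of the functional equations.\<close>

lemma EQ_split:
  assumes \<phi>: "poly_bounded \<phi>" and a: "0 \<le> a"
  shows "EQ a \<phi> = EP a \<phi> + \<beta> * EQ (a + \<beta>) (\<lambda>k. \<phi> (Suc k))"
proof -
  have a': "0 \<le> a + \<beta>" using a \<beta>_nonneg by simp
  have \<phi>': "poly_bounded (\<lambda>k. \<phi> (Suc k))" using \<phi> by (rule poly_bounded_Suc)
  have "(\<lambda>k. \<phi> (Suc k) * Q a (Suc k)) sums (EQ a \<phi> - \<phi> 0 * Q a 0)"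
    using EQ_sums[OF \<phi> a] by (subst sums_Suc_iff) simp
  moreover have "(\<lambda>k. \<phi> (Suc k) * P a (Suc k)) sums (EP a \<phi> - \<phi> 0 * P a 0)"
    using EP_sums[OF \<phi> a] by (subst sums_Suc_iff) simp
  moreover have "(\<lambda>k. \<beta> * (\<phi> (Suc k) * Q (a + \<beta>) k)) sums (\<beta> * EQ (a + \<beta>) (\<lambda>k. \<phi> (Suc k)))"
    using EQ_sums[OF \<phi>' a'] by (rule sums_mult)
  ultimately have "(\<lambda>k. \<phi> (Suc k) * Q a (Suc k) - \<phi> (Suc k) * P a (Suc k)
       - \<beta> * (\<phi> (Suc k) * Q (a + \<beta>) k)) sums
      (EQ a \<phi> - \<phi> 0 * Q a 0 - (EP a \<phi> - \<phi> 0 * P a 0) - \<beta> * EQ (a + \<beta>) (\<lambda>k. \<phi> (Suc k)))"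
    by (intro sums_diff)
  moreover have "\<phi> (Suc k) * Q a (Suc k) - \<phi> (Suc k) * P a (Suc k)
       - \<beta> * (\<phi> (Suc k) * Q (a + \<beta>) k) = 0" for k
    by (simp add: gen_poisson_Suc_eq_poisson algebra_simps)
  ultimately have "EQ a \<phi> - \<phi> 0 * Q a 0 - (EP a \<phi> - \<phi> 0 * P a 0)
      - \<beta> * EQ (a + \<beta>) (\<lambda>k. \<phi> (Suc k)) = 0"
    by (metis (no_types, lifting) sums_unique2 sums_zero sums_cong)
  moreover have "Q a 0 = P a 0" by (simp add: gen_poisson_0 poisson_weight_def)
  ultimately show ?thesis by simp
qed

text \<open>Size biasing: the factor \<open>k\<close> cancels in the factorial and removes the term
  at 0. It lowers the order of a moment by one.\<close>

lemma EP_size_bias: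
  assumes \<phi>: "poly_bounded \<phi>" and a: "0 \<le> a"
  shows "EP a (\<lambda>k. real k * \<phi> k) = a * EQ (a + \<beta>) (\<lambda>k. \<phi> (Suc k))"
proof -
  have a': "0 \<le> a + \<beta>" using a \<beta>_nonneg by simp
  have \<phi>': "poly_bounded (\<lambda>k. \<phi> (Suc k))" using \<phi> by (rule poly_bounded_Suc)
  have "(\<lambda>k. a * (\<phi> (Suc k) * Q (a + \<beta>) k)) sums (a * EQ (a + \<beta>) (\<lambda>k. \<phi> (Suc k)))"
    using EQ_sums[OF \<phi>' a'] by (rule sums_mult)
  also have "(\<lambda>k. a * (\<phi> (Suc k) * Q (a + \<beta>) k)) = (\<lambda>k. real (Suc k) * \<phi> (Suc k) * P a (Suc k))"
  proof
    fix k
    have "a * (\<phi> (Suc k) * Q (a + \<beta>) k) = \<phi> (Suc k) * (a * Q (a + \<beta>) k)" by (simp only: mult_ac)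
    also have "\<dots> = \<phi> (Suc k) * (real (Suc k) * P a (Suc k))"
      by (simp only: Suc_mult_gen_poisson_Suc)
    finally show "a * (\<phi> (Suc k) * Q (a + \<beta>) k) = real (Suc k) * \<phi> (Suc k) * P a (Suc k)"
      by (simp only: mult_ac)
  qed
  finally have "(\<lambda>k. real k * \<phi> k * P a k) sums (a * EQ (a + \<beta>) (\<lambda>k. \<phi> (Suc k)))"
    by (subst (asm) sums_Suc_iff) simp
  then show ?thesis unfolding EP_def by (simp add: sums_iff)
qed

text \<open>With \<open>F\<close> the partial sum, \<open>exp s * (F s - 1)\<close> vanishes at 0,
  and its derivative is \<open>exp s\<close> times the shorter sum at \<open>s + \<beta>\<close>
  minus 1, nonpositive by induction. The hypothesis is used at \<open>s + \<beta>\<close>, hence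
  \<open>a\<close> is generalised.\<close>

lemma sum_P_le_1:
  assumes "0 \<le> a"
  shows "(\<Sum>k\<le>K. P a k) \<le> 1"
  using assms
proof (induction K arbitrary: a)
  case 0
  then show ?case by (simp add: gen_poisson_0)
next
  case (Suc K)
  let ?F = "\<lambda>a. \<Sum>k\<le>Suc K. P a k"
  have dF: "(?F has_real_derivative ((\<Sum>k\<le>K. P (s + \<beta>) k) - ?F s)) (at s)" for s :: real
  proof -
    have "(?F has_real_derivative (- P s 0 + (\<Sum>k\<le>K. P (s + \<beta>) k - P s (Suc k)))) (at s)"
      unfolding sum.atMost_Suc_shift
      by (intro DERIV_add DERIV_sum gen_poisson_has_derivative_0 gen_poisson_has_derivative_Suc)
    then show ?thesis
      unfolding sum.atMost_Suc_shift by (simp add: sum_subtractf algebra_simps)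
  qed
  have "exp a * ?F a - exp a \<le> exp 0 * ?F 0 - exp 0"
  proof (rule DERIV_nonpos_imp_nonincreasing[where f = "\<lambda>s. exp s * ?F s - exp s", OF Suc.prems])
    fix s :: real assume s: "0 \<le> s"
    have "((\<lambda>s. exp s * ?F s - exp s) has_real_derivative
        (exp s * ((\<Sum>k\<le>K. P (s + \<beta>) k) - ?F s) + exp s * ?F s - exp s)) (at s)"
      by (rule DERIV_cong, rule DERIV_diff[OF DERIV_mult[OF DERIV_exp dF] DERIV_exp]) (simp add: mult_ac)
    moreover have "exp s * ((\<Sum>k\<le>K. P (s + \<beta>) k) - ?F s) + exp s * ?F s - exp s \<le> 0"
    proof -
      have "(\<Sum>k\<le>K. P (s + \<beta>) k) \<le> 1" using s \<beta>_nonneg by (intro Suc.IH) simp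
      then have "exp s * (\<Sum>k\<le>K. P (s + \<beta>) k) \<le> exp s * 1" by (intro mult_left_mono) auto
      then show ?thesis by (simp add: algebra_simps)
    qed
    ultimately show "\<exists>y. ((\<lambda>s. exp s * ?F s - exp s) has_real_derivative y) (at s) \<and> y \<le> 0"
      by blast
  qed
  moreover have "?F 0 = 1"
    unfolding sum.atMost_Suc_shift by (simp add: gen_poisson_0 gen_poisson_Suc)
  ultimately have "exp a * ?F a \<le> exp a * 1" by simp
  then show ?case using mult_le_cancel_left_pos[of "exp a" "?F a" 1] by simp
qed

lemma EP_1_le_1: "0 \<le> a \<Longrightarrow> EP a (\<lambda>k. 1) \<le> 1"
proof -
  assume a: "0 \<le> a"
  have "(\<lambda>k. P a k) sums EP a (\<lambda>k. 1)" using EP_sums[of "\<lambda>k. 1" a] a by simp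
  then have "(\<lambda>K. \<Sum>k\<le>K. P a k) \<longlonglongrightarrow> EP a (\<lambda>k. 1)" by (simp add: sums_def_le)
  then show ?thesis by (rule LIMSEQ_le_const2) (use sum_P_le_1[OF a] in auto)
qed

lemma EP_1_has_derivative:
  assumes "0 \<le> a" and "a \<le> A"
  shows "((\<lambda>a. EP a (\<lambda>k. 1)) has_real_derivative
      EP (a + \<beta>) (\<lambda>k. 1) - EP a (\<lambda>k. 1)) (at a within {0..A})"
proof -
  define P' where "P' = (\<lambda>k a. (case k of 0 \<Rightarrow> 0 | Suc m \<Rightarrow> P (a + \<beta>) m) - P a k)"
  obtain \<mu> \<rho> where \<mu>: "0 < \<mu>" and \<rho>: "0 < \<rho>" "\<rho> < 1"
    and tail: "\<And>j. \<exists>C\<ge>0. \<forall>a\<ge>0. \<forall>k. (real k + 1 + a) ^ j * Q a k \<le> C * exp (\<mu> * a) * \<rho> ^ k"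
    by (rule Q_tail) blast
  from tail[of 0] obtain C where C: "0 \<le> C"
    "\<And>a k. 0 \<le> a \<Longrightarrow> Q a k \<le> C * exp (\<mu> * a) * \<rho> ^ k" by auto
  \<comment> \<open>The range extends to \<open>A + \<beta>\<close> because the derivative contains
    weights at \<open>a + \<beta>\<close>.\<close>
  have PC: "P a k \<le> C * exp (\<mu> * (A + \<beta>)) * \<rho> ^ k" if "0 \<le> a" "a \<le> A + \<beta>" for a k
  proof -
    have "P a k \<le> C * exp (\<mu> * a) * \<rho> ^ k" using P_le_Q[of a k] C(2)[of a k] that by linarith
    also have "\<dots> \<le> C * exp (\<mu> * (A + \<beta>)) * \<rho> ^ k"
      using that \<mu> C(1) \<rho> by (intro mult_right_mono mult_left_mono) auto
    finally show ?thesis .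
  qed
  have unif: "uniform_limit {0..A} (\<lambda>n a. \<Sum>k<n. P' k a) (\<lambda>a. \<Sum>k. P' k a) sequentially"
  proof (rule Weierstrass_m_test)
    fix k a assume "a \<in> {0..A}"
    then have a: "0 \<le> a" "a \<le> A" by auto
    \<comment> \<open>The summand divided by \<open>\<rho>\<close> is the majorant at index
      \<open>k - 1\<close>, for the shifted weight.\<close>
    show "norm (P' k a) \<le> C * exp (\<mu> * (A + \<beta>)) * \<rho> ^ k / \<rho> + C * exp (\<mu> * (A + \<beta>)) * \<rho> ^ k"
    proof (cases k)
      case 0
      have "norm (P' k a) \<le> P a k" using P_nonneg[OF a(1)] by (simp add: P'_def 0)
      also have "\<dots> \<le> C * exp (\<mu> * (A + \<beta>)) * \<rho> ^ k" using a \<beta>_nonneg by (intro PC) auto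
      finally show ?thesis using C(1) \<rho> by (simp add: add_increasing)
    next
      case (Suc m)
      have "norm (P' k a) \<le> P (a + \<beta>) m + P a k"
        using P_nonneg[OF a(1), of k] P_nonneg[of "a + \<beta>" m] a \<beta>_nonneg by (simp add: P'_def Suc)
      also have "\<dots> \<le> C * exp (\<mu> * (A + \<beta>)) * \<rho> ^ m + C * exp (\<mu> * (A + \<beta>)) * \<rho> ^ k"
        using a \<beta>_nonneg by (intro add_mono PC) auto
      also have "C * exp (\<mu> * (A + \<beta>)) * \<rho> ^ m = C * exp (\<mu> * (A + \<beta>)) * \<rho> ^ k / \<rho>"
        using \<rho> by (simp add: Suc)
      finally show ?thesis .
    qed
  next
    show "summable (\<lambda>k. C * exp (\<mu> * (A + \<beta>)) * \<rho> ^ k / \<rho> + C * exp (\<mu> * (A + \<beta>)) * \<rho> ^ k)"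
      using \<rho> by (intro summable_add summable_mult summable_divide summable_geometric) auto
  qed
  have "\<exists>g. \<forall>a\<in>{0..A}. (\<lambda>k. P a k) sums g a \<and>
      (g has_field_derivative (\<Sum>k. P' k a)) (at a within {0..A})"
  proof (rule has_field_derivative_series[OF _ _ unif])
    show "((\<lambda>a. P a k) has_real_derivative P' k a) (at a within {0..A})" for k a
      unfolding P'_def
      by (cases k) (use gen_poisson_has_derivative_0 gen_poisson_has_derivative_Suc in auto)
    show "a \<in> {0..A}" using assms by simp
    show "summable (\<lambda>k. P a k)" using summable_P[of "\<lambda>k. 1" a] assms by simp
  qed auto
  then obtain g where g: "\<And>a. a \<in> {0..A} \<Longrightarrow> (\<lambda>k. P a k) sums g a"
    "\<And>a. a \<in> {0..A} \<Longrightarrow> (g has_field_derivative (\<Sum>k. P' k a)) (at a within {0..A})" by blast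
  have gE: "g a = EP a (\<lambda>k. 1)" if "a \<in> {0..A}" for a
    using g(1)[OF that] by (simp add: EP_def sums_iff)
  have "(\<lambda>k. case k of 0 \<Rightarrow> 0 | Suc m \<Rightarrow> P (a + \<beta>) m) sums EP (a + \<beta>) (\<lambda>k. 1)"
    using sums_Suc[of "\<lambda>k. case k of 0 \<Rightarrow> 0 | Suc m \<Rightarrow> P (a + \<beta>) m" "EP (a + \<beta>) (\<lambda>k. 1)"]
      EP_sums[of "\<lambda>k. 1" "a + \<beta>"] assms \<beta>_nonneg by simp
  moreover have "(\<lambda>k. P a k) sums EP a (\<lambda>k. 1)" using EP_sums[of "\<lambda>k. 1" a] assms by simp
  ultimately have "(\<lambda>k. P' k a) sums (EP (a + \<beta>) (\<lambda>k. 1) - EP a (\<lambda>k. 1))"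
    unfolding P'_def by (rule sums_diff)
  then have S: "(\<Sum>k. P' k a) = EP (a + \<beta>) (\<lambda>k. 1) - EP a (\<lambda>k. 1)" by (simp add: sums_iff)
  have "(g has_field_derivative (\<Sum>k. P' k a)) (at a within {0..A})" using g(2) assms by simp
  then show ?thesis
    unfolding S by (rule has_field_derivative_transform_within[where d = 1]) (use assms gE in auto)
qed

text \<open>
  The deficit \<open>G a = 1 - EP a (\<lambda>k. 1)\<close> satisfies \<open>G' a = G (a + \<beta>) - G a\<close>, so \<open>G a\<close> differs from the
  integral of \<open>G\<close> over \<open>[a, a + \<beta>]\<close> by a constant, which is nonpositive since \<open>G 0 = 0\<close>.
  Hence \<open>sup G \<le> \<beta> sup G\<close>.
\<close>
lemma EP_1:
  assumes "0 \<le> a"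
  shows "EP a (\<lambda>k. 1) = 1"
proof -
  define G where "G = (\<lambda>a. 1 - EP a (\<lambda>k. 1))"
  have G0: "0 \<le> G a" if "0 \<le> a" for a using EP_1_le_1[OF that] by (simp add: G_def)
  have dG: "(G has_real_derivative G (a + \<beta>) - G a) (at a within {0..A})" if "0 \<le> a" "a \<le> A" for a A
    unfolding G_def by (rule DERIV_cong[OF DERIV_diff[OF DERIV_const EP_1_has_derivative[OF that]]]) simp
  have cG: "continuous_on {0..A} G" for A
    using dG by (auto intro!: DERIV_continuous_on)
  define \<Phi> where "\<Phi> = (\<lambda>a. integral {0..a} G)"
  have d\<Phi>: "(\<Phi> has_real_derivative G a) (at a within {0..A})" if "0 \<le> a" "a \<le> A" for a A
    unfolding \<Phi>_def by (rule integral_has_real_derivative[OF cG]) (use that in auto)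
  have interior: "(f has_real_derivative D) (at s)"
    if "0 < s" "(f has_real_derivative D) (at s within {0..s + 1})" for f D and s :: real
    using that at_within_Icc_at[of 0 s "s + 1"] by simp
  have c\<Phi>: "continuous_on {0..A} \<Phi>" for A
    using d\<Phi> by (auto intro!: DERIV_continuous_on)
  have G_0: "G 0 = 0"
  proof -
    have "EP 0 (\<lambda>k. 1) = (\<Sum>k. if k \<in> {0::nat} then 1 else 0)" unfolding EP_def P_at_0 by simp
    also have "\<dots> = 1" using sums_If_finite_set[of "{0::nat}" "\<lambda>_. 1::real"] by (simp add: sums_iff)
    finally show ?thesis by (simp add: G_def)
  qed
  have mvt: "\<Phi> (a + \<beta>) - \<Phi> a \<le> \<beta> * M" if a: "0 \<le> a" and M: "\<And>s. 0 \<le> s \<Longrightarrow> G s \<le> M" for a M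
  proof (cases "\<beta> = 0")
    case False
    then have \<beta>: "a < a + \<beta>" using \<beta>_nonneg by simp
    obtain z where z: "a < z" "\<Phi> (a + \<beta>) - \<Phi> a = G z * (a + \<beta> - a)"
    proof -
      have "(\<Phi> has_derivative (*) (G s)) (at s within {a..a + \<beta>})" if "a \<le> s" "s \<le> a + \<beta>" for s
        using has_field_derivative_subset[OF d\<Phi>[of s "a + \<beta>"], of "{a..a + \<beta>}"] a that
        by (auto simp: has_field_derivative_def)
      then show thesis
        using mvt_simple[OF \<beta>, of \<Phi> "\<lambda>s. (*) (G s)"] that by auto
    qed
    then show ?thesis
      using mult_right_mono[OF M[of z] \<beta>_nonneg] a by (simp add: mult.commute)
  qed simp
  have \<Phi>\<beta>: "0 \<le> \<Phi> \<beta>"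
    unfolding \<Phi>_def by (rule integral_nonneg[OF integrable_continuous_interval[OF cG]]) (use G0 in auto)
  have key: "G a \<le> \<Phi> (a + \<beta>) - \<Phi> a" if a: "0 \<le> a" for a
  proof (cases "a = 0")
    case True
    then show ?thesis using \<Phi>\<beta> G_0 by (simp add: \<Phi>_def)
  next
    case False
    then have pos: "0 < a" using a by simp
    \<comment> \<open>Its derivative is zero, and its value at 0 is \<open>- \<Phi> \<beta>\<close>
      since \<open>G\<close> and \<open>\<Phi>\<close> vanish there.\<close>
    let ?\<Psi> = "\<lambda>s. G s - (\<Phi> (s + \<beta>) - \<Phi> s)"
    have "?\<Psi> a = ?\<Psi> 0"
    proof (rule DERIV_isconst_end[OF pos])
      show "continuous_on {0..a} ?\<Psi>"
        by (intro continuous_on_diff cG c\<Phi> continuous_on_compose2[OF c\<Phi>[of "a + \<beta>"]] continuous_intros)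
           (use \<beta>_nonneg in auto)
      fix s :: real assume s: "0 < s" "s < a"
      have "(G has_real_derivative G (s + \<beta>) - G s) (at s)" "(\<Phi> has_real_derivative G s) (at s)"
        using s by (auto intro!: interior dG d\<Phi>)
      moreover have "((\<lambda>s. \<Phi> (s + \<beta>)) has_real_derivative G (s + \<beta>)) (at s)"
        using s \<beta>_nonneg by (intro DERIV_shift[THEN iffD1] interior d\<Phi>) auto
      ultimately show "(?\<Psi> has_real_derivative 0) (at s)"
        by (auto intro!: derivative_eq_intros)
    qed
    then show ?thesis using \<Phi>\<beta> G_0 by (simp add: \<Phi>_def)
  qed
  \<comment> \<open>The supremum argument as an iteration: \<open>G \<le> 1\<close> at the start,
    and each pass through \<open>key\<close> and \<open>mvt\<close> gains a factor
    \<open>\<beta>\<close>.\<close>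
  have "G a \<le> \<beta> ^ m" if "0 \<le> a" for a m
    using that
  proof (induction m arbitrary: a)
    case 0
    have "0 \<le> EP a (\<lambda>k. 1)"
      unfolding EP_def using 0 by (intro suminf_nonneg summable_P mult_nonneg_nonneg P_nonneg) auto
    then show ?case by (simp add: G_def)
  next
    case (Suc m)
    then show ?case using key[of a] mvt[of a "\<beta> ^ m"] by simp
  qed
  then have "G a \<le> 0"
    using assms LIMSEQ_realpow_zero[OF \<beta>_nonneg \<beta>_less_1] by (intro LIMSEQ_le_const) auto
  then show ?thesis using G0[OF assms] by (simp add: G_def)
qed

subsection \<open>Central moments of the generalized Poisson distribution\<close>

text \<open>The difference \<open>D\<close> to the affine solution satisfies
  \<open>D a = \<beta> * D (a + \<beta>)\<close>. After \<open>m\<close> iterations the gain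
  \<open>\<beta> ^ m\<close> outweighs the growth \<open>exp (\<mu> * m * \<beta>)\<close>, so
  \<open>D a\<close> is 0.\<close>

lemma affine_fixpoint:
  fixes h :: "real \<Rightarrow> real"
  assumes rec: "\<And>a. 0 \<le> a \<Longrightarrow> h a = c0 + c1 * a + \<beta> * h (a + \<beta>)"
    and bound: "\<And>a. 0 \<le> a \<Longrightarrow> \<bar>h a\<bar> \<le> C * exp (\<mu> * a)"
    and \<mu>: "0 < \<mu>" "\<beta> * exp (\<mu> * \<beta>) < 1"
    and a: "0 \<le> a"
  shows "h a = c1 / (1 - \<beta>) * a + (c0 + \<beta>\<^sup>2 * (c1 / (1 - \<beta>))) / (1 - \<beta>)"
proof -
  \<comment> \<open>\<open>A\<close> and \<open>B\<close> come from inserting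
    \<open>A * a + B\<close> and comparing coefficients; the term \<open>\<beta>\<^sup>2 * A\<close>
    stems from the shift of the argument by \<open>\<beta>\<close>.\<close>
  define A where "A = c1 / (1 - \<beta>)"
  define B where "B = (c0 + \<beta>\<^sup>2 * A) / (1 - \<beta>)"
  define D where "D = (\<lambda>a. h a - (A * a + B))"
  have "A * (1 - \<beta>) = c1" "B * (1 - \<beta>) = c0 + \<beta>\<^sup>2 * A"
    using \<beta>_less_1 by (simp_all add: A_def B_def)
  then have A: "A = c1 + \<beta> * A" and B: "B = c0 + \<beta>\<^sup>2 * A + \<beta> * B"
    by (simp_all add: algebra_simps)
  have D_rec: "D a = \<beta> * D (a + \<beta>)" if "0 \<le> a" for a
  proof -
    have "A * a + B = (c1 + \<beta> * A) * a + (c0 + \<beta>\<^sup>2 * A + \<beta> * B)" using A B by presburger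
    then show ?thesis
      unfolding D_def using rec[OF that] by (simp add: algebra_simps power2_eq_square)
  qed
  have D_iter: "D a = \<beta> ^ m * D (a + real m * \<beta>)" for m
  proof (induction m)
    case (Suc m)
    then show ?case using D_rec[of "a + real m * \<beta>"] a \<beta>_nonneg by (simp add: algebra_simps)
  qed simp
  define K where "K = C + (\<bar>A\<bar> / \<mu> + \<bar>B\<bar>)"
  have D_bound: "\<bar>D a\<bar> \<le> K * exp (\<mu> * a)" if "0 \<le> a" for a
  proof -
    have 1: "\<mu> * a \<le> exp (\<mu> * a)" "1 \<le> exp (\<mu> * a)"
      using exp_ge_add_one_self[of "\<mu> * a"] that \<mu>(1) by (auto simp del: exp_ge_add_one_self)
    have "\<bar>A * a + B\<bar> \<le> \<bar>A\<bar> / \<mu> * (\<mu> * a) + \<bar>B\<bar> * 1"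
      using \<mu>(1) that abs_triangle_ineq[of "A * a" B] by (simp add: abs_mult)
    also have "\<dots> \<le> \<bar>A\<bar> / \<mu> * exp (\<mu> * a) + \<bar>B\<bar> * exp (\<mu> * a)"
      using 1 \<mu>(1) by (intro add_mono mult_left_mono) auto
    finally show ?thesis
      using bound[OF that] abs_triangle_ineq4[of "h a" "A * a + B"]
      by (simp add: D_def K_def distrib_right)
  qed
  have "\<bar>D a\<bar> \<le> K * exp (\<mu> * a) * (\<beta> * exp (\<mu> * \<beta>)) ^ m" for m
  proof -
    have "\<bar>D a\<bar> = \<beta> ^ m * \<bar>D (a + real m * \<beta>)\<bar>"
      using D_iter[of m] \<beta>_nonneg by (simp add: abs_mult)
    also have "\<dots> \<le> \<beta> ^ m * (K * exp (\<mu> * (a + real m * \<beta>)))"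
      using a \<beta>_nonneg by (intro mult_left_mono D_bound) auto
    also have "exp (\<mu> * (a + real m * \<beta>)) = exp (\<mu> * a) * exp (\<mu> * \<beta>) ^ m"
      by (simp add: exp_of_nat_mult[symmetric] mult_exp_exp algebra_simps)
    finally show ?thesis by (simp add: power_mult_distrib mult_ac)
  qed
  moreover have "(\<lambda>m. K * exp (\<mu> * a) * (\<beta> * exp (\<mu> * \<beta>)) ^ m) \<longlonglongrightarrow> K * exp (\<mu> * a) * 0"
    using \<beta>_nonneg \<mu>(2) by (intro tendsto_intros LIMSEQ_realpow_zero) auto
  ultimately have "\<bar>D a\<bar> \<le> 0" by (intro LIMSEQ_le_const[of _ 0]) auto
  then show ?thesis by (simp add: D_def A_def B_def)
qed

definition Y :: "real \<Rightarrow> nat \<Rightarrow> real" where "Y a k = real k * (1 - \<beta>) - a"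
definition mP :: "nat \<Rightarrow> real \<Rightarrow> real" where "mP j a = EP a (\<lambda>k. Y a k ^ j)"
definition mQ :: "nat \<Rightarrow> real \<Rightarrow> real" where "mQ j a = EQ a (\<lambda>k. Y a k ^ j)"

lemma poly_bounded_Y [intro, simp]: "poly_bounded (Y a)"
  unfolding Y_def[abs_def] by (intro poly_bounded_diff poly_bounded_mult poly_bounded_of_nat poly_bounded_const)

text \<open>The step in \<open>k\<close> adds \<open>1 - \<beta>\<close> and the return from
  \<open>a + \<beta>\<close> to \<open>a\<close> adds \<open>\<beta>\<close>; so the shifts in
  \<open>EQ_split\<close> and \<open>EP_size_bias\<close> move the centred variable by a constant,
  and the recursions stay within centred moments.\<close>

lemma Y_Suc: "Y a (Suc k) = Y (a + \<beta>) k + 1"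
  by (simp add: Y_def algebra_simps)

lemma mQ_rec:
  assumes "0 \<le> a"
  shows "mQ j a = mP j a + \<beta> * EQ (a + \<beta>) (\<lambda>k. (Y (a + \<beta>) k + 1) ^ j)"
  unfolding mQ_def mP_def using EQ_split[of "\<lambda>k. Y a k ^ j" a] assms
  by (auto simp: Y_Suc)

text \<open>One factor of the power is written as \<open>(1 - \<beta>) k - a\<close>; size biasing
  turns the part with \<open>k\<close> into a \<open>Q\<close>-sum of order
  \<open>j\<close>.\<close>

lemma mP_rec:
  assumes "0 \<le> a"
  shows "mP (Suc j) a = (1 - \<beta>) * a * EQ (a + \<beta>) (\<lambda>k. (Y (a + \<beta>) k + 1) ^ j) - a * mP j a"
proof -
  have "Y a k ^ Suc j = (1 - \<beta>) * (real k * Y a k ^ j) + (- a) * Y a k ^ j" for k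
    by (simp add: Y_def algebra_simps)
  then have "mP (Suc j) a = EP a (\<lambda>k. (1 - \<beta>) * (real k * Y a k ^ j) + (- a) * Y a k ^ j)"
    by (simp only: mP_def)
  also have "\<dots> = (1 - \<beta>) * EP a (\<lambda>k. real k * Y a k ^ j) + (- a) * EP a (\<lambda>k. Y a k ^ j)"
    using assms
    by (simp only: EP_add EP_cmult poly_bounded_mult poly_bounded_power poly_bounded_of_nat
        poly_bounded_const poly_bounded_Y)
  also have "EP a (\<lambda>k. real k * Y a k ^ j) = a * EQ (a + \<beta>) (\<lambda>k. (Y (a + \<beta>) k + 1) ^ j)"
    using EP_size_bias[of "\<lambda>k. Y a k ^ j" a] assms by (auto simp: Y_Suc)
  finally show ?thesis by (simp add: mP_def)
qed

text \<open>Since \<open>\<bar>Y a k\<bar> \<le> k + 1 + a\<close>, the tail bound for this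
  \<open>j\<close> puts \<open>mQ j\<close> into the growth class in which
  \<open>affine_fixpoint\<close> applies.\<close>

lemma mQ_affine:
  assumes "\<And>a. 0 \<le> a \<Longrightarrow> mQ j a = c0 + c1 * a + \<beta> * mQ j (a + \<beta>)" and "0 \<le> a"
  shows "mQ j a = c1 / (1 - \<beta>) * a + (c0 + \<beta>\<^sup>2 * (c1 / (1 - \<beta>))) / (1 - \<beta>)"
proof -
  obtain \<mu> \<rho> where \<mu>: "0 < \<mu>" "\<beta> * exp (\<mu> * \<beta>) < 1" and \<rho>: "0 < \<rho>" "\<rho> < 1"
    and tail: "\<And>j. \<exists>C\<ge>0. \<forall>a\<ge>0. \<forall>k. (real k + 1 + a) ^ j * Q a k \<le> C * exp (\<mu> * a) * \<rho> ^ k"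
    by (rule Q_tail) blast
  from tail[of j] obtain C where C: "0 \<le> C"
    "\<And>a k. 0 \<le> a \<Longrightarrow> (real k + 1 + a) ^ j * Q a k \<le> C * exp (\<mu> * a) * \<rho> ^ k" by blast
  have "\<bar>mQ j a\<bar> \<le> C / (1 - \<rho>) * exp (\<mu> * a)" if a: "0 \<le> a" for a
  proof -
    have le: "\<bar>Y a k ^ j * Q a k\<bar> \<le> C * exp (\<mu> * a) * \<rho> ^ k" for k
    proof -
      have "0 \<le> real k * (1 - \<beta>)" "real k * (1 - \<beta>) \<le> real k"
        using \<beta>_nonneg \<beta>_less_1 by (auto simp: mult_left_le)
      then have "\<bar>Y a k\<bar> \<le> real k + 1 + a" using a by (auto simp: Y_def abs_le_iff)
      then have "\<bar>Y a k\<bar> ^ j * Q a k \<le> (real k + 1 + a) ^ j * Q a k"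
        by (intro mult_right_mono power_mono Q_nonneg a) auto
      then show ?thesis using C(2)[OF a, of k] Q_nonneg[OF a] by (simp add: abs_mult power_abs)
    qed
    have s: "(\<lambda>k. C * exp (\<mu> * a) * \<rho> ^ k) sums (C * exp (\<mu> * a) * (1 / (1 - \<rho>)))"
      using \<rho> by (intro sums_mult geometric_sums) auto
    have "\<bar>mQ j a\<bar> \<le> (\<Sum>k. C * exp (\<mu> * a) * \<rho> ^ k)"
      unfolding mQ_def EQ_def real_norm_def[symmetric]
      by (rule norm_suminf_le[OF _ sums_summable[OF s]]) (use le in auto)
    also have "\<dots> = C / (1 - \<rho>) * exp (\<mu> * a)" using s by (simp add: sums_iff)
    finally show ?thesis .
  qed
  from affine_fixpoint[of "mQ j", OF assms(1) this \<mu> assms(2)] show ?thesis .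
qed

lemma EQ_Y_add_1:
  assumes "0 \<le> a"
  shows "EQ a (\<lambda>k. (Y a k + 1) ^ 0) = mQ 0 a"
    and "EQ a (\<lambda>k. (Y a k + 1) ^ 1) = mQ 1 a + mQ 0 a"
    and "EQ a (\<lambda>k. (Y a k + 1) ^ 2) = mQ 2 a + 2 * mQ 1 a + mQ 0 a"
    and "EQ a (\<lambda>k. (Y a k + 1) ^ 3) = mQ 3 a + 3 * mQ 2 a + 3 * mQ 1 a + mQ 0 a"
proof -
  note pb = poly_bounded_add poly_bounded_mult poly_bounded_power poly_bounded_const poly_bounded_Y
  show "EQ a (\<lambda>k. (Y a k + 1) ^ 0) = mQ 0 a" by (simp add: mQ_def)
  show "EQ a (\<lambda>k. (Y a k + 1) ^ 1) = mQ 1 a + mQ 0 a"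
    using EQ_add[of "\<lambda>k. Y a k ^ 1" "\<lambda>k. Y a k ^ 0" a] assms by (simp add: mQ_def pb)
  have "EQ a (\<lambda>k. (Y a k + 1) ^ 2) = EQ a (\<lambda>k. Y a k ^ 2 + (2 * Y a k ^ 1 + Y a k ^ 0))"
    by (rule arg_cong[of _ _ "EQ a"]) (auto simp: fun_eq_iff power2_eq_square algebra_simps)
  also have "\<dots> = mQ 2 a + (2 * mQ 1 a + mQ 0 a)"
    unfolding mQ_def using assms by (simp add: EQ_add EQ_cmult pb del: power_0 power_one_right)
  finally show "EQ a (\<lambda>k. (Y a k + 1) ^ 2) = mQ 2 a + 2 * mQ 1 a + mQ 0 a" by simp
  have "EQ a (\<lambda>k. (Y a k + 1) ^ 3)
      = EQ a (\<lambda>k. Y a k ^ 3 + (3 * Y a k ^ 2 + (3 * Y a k ^ 1 + Y a k ^ 0)))"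
    by (rule arg_cong[of _ _ "EQ a"]) (auto simp: fun_eq_iff power2_eq_square power3_eq_cube algebra_simps)
  also have "\<dots> = mQ 3 a + (3 * mQ 2 a + (3 * mQ 1 a + mQ 0 a))"
    unfolding mQ_def using assms by (simp add: EQ_add EQ_cmult pb del: power_0 power_one_right)
  finally show "EQ a (\<lambda>k. (Y a k + 1) ^ 3) = mQ 3 a + 3 * mQ 2 a + 3 * mQ 1 a + mQ 0 a" by simp
qed

text \<open>A ladder: if \<open>mP j\<close> is affine, \<open>mQ_rec\<close> becomes an equation of
  the kind solved by \<open>mQ_affine\<close>; with \<open>mQ j\<close> affine,
  \<open>mP_rec\<close> gives the next \<open>mP\<close>. It passes through orders 0 to 3 and ends
  with \<open>mP 4\<close> quadratic in \<open>a\<close>, which is the order needed against the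
  later division by \<open>n ^ 3\<close>.\<close>

lemma
  shows mP_1: "0 \<le> a \<Longrightarrow> mP 1 a = 0"
    and mP_2: "0 \<le> a \<Longrightarrow> mP 2 a = a / (1 - \<beta>)"
    and mP_4: "\<exists>c\<ge>0. \<forall>a\<ge>0. mP 4 a \<le> c * (1 + a\<^sup>2)"
proof -
  have shift: "0 \<le> a + \<beta>" if "0 \<le> a" for a using that \<beta>_nonneg by simp
  note S = EQ_Y_add_1[OF shift]
  have p0: "mP 0 a = 1" if "0 \<le> a" for a using EP_1[OF that] by (simp add: mP_def)
  have q0: "mQ 0 a = 1 / (1 - \<beta>)" if "0 \<le> a" for a
    using mQ_affine[of 0 1 0 a] mQ_rec[of _ 0] S(1) p0 that by simp
  show p1: "mP 1 a = 0" if "0 \<le> a" for a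
    using mP_rec[of a 0] S(1)[of a] p0[of a] q0[of "a + \<beta>"] shift[of a] that \<beta>_less_1 by simp
  define B1 where "B1 = \<beta> / (1 - \<beta>)\<^sup>2"
  have q1: "mQ 1 a = B1" if "0 \<le> a" for a
  proof -
    have "mQ 1 a = \<beta> / (1 - \<beta>) + 0 * a + \<beta> * mQ 1 (a + \<beta>)" if "0 \<le> a" for a
      unfolding mQ_rec[OF that, of 1] S(2)[OF that] p1[OF that] q0[OF shift[OF that]]
      by (simp add: distrib_left)
    from mQ_affine[OF this that] show ?thesis by (simp add: B1_def power2_eq_square)
  qed
  have b1: "B1 + 1 / (1 - \<beta>) = 1 / (1 - \<beta>)\<^sup>2"
  proof -
    have "1 / (1 - \<beta>) = (1 - \<beta>) / (1 - \<beta>)\<^sup>2" using \<beta>_less_1 by (simp add: power2_eq_square)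
    then show ?thesis by (simp add: B1_def add_divide_distrib[symmetric])
  qed
  show p2: "mP 2 a = a / (1 - \<beta>)" if "0 \<le> a" for a
  proof -
    have "mP 2 a = (1 - \<beta>) * a * (B1 + 1 / (1 - \<beta>))"
      using mP_rec[of a 1] S(2)[of a] p1[of a] q0[of "a + \<beta>"] q1[of "a + \<beta>"] shift[of a] that
      by (simp add: numeral_2_eq_2)
    then show ?thesis unfolding b1 using \<beta>_less_1 by (simp add: power2_eq_square)
  qed
  define A2 where "A2 = 1 / (1 - \<beta>)\<^sup>2"
  define B2 where "B2 = (\<beta> * (2 * B1 + 1 / (1 - \<beta>)) + \<beta>\<^sup>2 * A2) / (1 - \<beta>)"
  have q2: "mQ 2 a = A2 * a + B2" if "0 \<le> a" for a
  proof -
    have "mQ 2 a = \<beta> * (2 * B1 + 1 / (1 - \<beta>)) + 1 / (1 - \<beta>) * a + \<beta> * mQ 2 (a + \<beta>)" if "0 \<le> a" for a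
      using mQ_rec[of a 2] S(3)[of a] p2[of a] q0[of "a + \<beta>"] q1[of "a + \<beta>"] shift[of a] that
      by (simp add: algebra_simps)
    from mQ_affine[OF this that] show ?thesis
      unfolding A2_def B2_def by (simp add: power2_eq_square)
  qed
  define C3 where "C3 = (1 - \<beta>) * (A2 * \<beta> + B2 + 2 * B1 + 1 / (1 - \<beta>))"
  \<comment> \<open>The cancellation of the coefficient of \<open>a * a\<close> in
    \<open>mP 3\<close>; without it the equation for \<open>mQ 3\<close> would have a quadratic
    source term and the ladder would break.\<close>
  have A2': "(1 - \<beta>) * A2 = 1 / (1 - \<beta>)"
    using \<beta>_less_1 by (simp add: A2_def power2_eq_square)
  have p3: "mP 3 a = C3 * a" if "0 \<le> a" for a
  proof -
    have "mP 3 a = (1 - \<beta>) * a * (A2 * (a + \<beta>) + B2 + 2 * B1 + 1 / (1 - \<beta>)) - a * (a / (1 - \<beta>))"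
      using mP_rec[of a 2] S(3)[of a] p2[of a] q0[of "a + \<beta>"] q1[of "a + \<beta>"] q2[of "a + \<beta>"] shift[of a] that
      by (simp add: numeral_3_eq_3 numeral_2_eq_2)
    also have "\<dots> = C3 * a + a * a * ((1 - \<beta>) * A2 - 1 / (1 - \<beta>))"
    proof -
      define w where "w = 1 / (1 - \<beta>)"
      have w: "a / (1 - \<beta>) = a * w" by (simp add: w_def)
      show ?thesis unfolding C3_def w w_def[symmetric] by (simp add: algebra_simps)
    qed
    finally show ?thesis unfolding A2' by simp
  qed
  define c0 where "c0 = \<beta> * (3 * (A2 * \<beta> + B2) + 3 * B1 + 1 / (1 - \<beta>))"
  define c1 where "c1 = C3 + \<beta> * (3 * A2)"
  define A3 where "A3 = c1 / (1 - \<beta>)"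
  define B3 where "B3 = (c0 + \<beta>\<^sup>2 * (c1 / (1 - \<beta>))) / (1 - \<beta>)"
  have q3: "mQ 3 a = A3 * a + B3" if "0 \<le> a" for a
  proof -
    have "mQ 3 a = c0 + c1 * a + \<beta> * mQ 3 (a + \<beta>)" if "0 \<le> a" for a
      using mQ_rec[of a 3] S(4)[of a] p3[of a] q0[of "a + \<beta>"] q1[of "a + \<beta>"] q2[of "a + \<beta>"] shift[of a] that
      by (simp add: c0_def c1_def algebra_simps)
    from mQ_affine[OF this that] show ?thesis unfolding A3_def B3_def .
  qed
  define u where "u = (1 - \<beta>) * (A3 * \<beta> + B3 + 3 * (A2 * \<beta> + B2) + 3 * B1 + 1 / (1 - \<beta>))"
  define v where "v = (1 - \<beta>) * (A3 + 3 * A2) - C3"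
  have p4: "mP 4 a = u * a + v * a\<^sup>2" if "0 \<le> a" for a
  proof -
    have "mP 4 a = (1 - \<beta>) * a * (A3 * (a + \<beta>) + B3 + 3 * (A2 * (a + \<beta>) + B2) + 3 * B1 + 1 / (1 - \<beta>))
        - a * (C3 * a)"
      using mP_rec[of a 3] S(4)[of a] p3[of a] q0[of "a + \<beta>"] q1[of "a + \<beta>"] q2[of "a + \<beta>"]
        q3[of "a + \<beta>"] shift[of a] that
      by (simp add: eval_nat_numeral)
    moreover have "(1 - \<beta>) * a * (A3 * (a + \<beta>) + B3 + 3 * (A2 * (a + \<beta>) + B2) + 3 * B1 + w)
        - a * (C3 * a) = (1 - \<beta>) * (A3 * \<beta> + B3 + 3 * (A2 * \<beta> + B2) + 3 * B1 + w) * a + v * a\<^sup>2" for w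
      unfolding v_def by (simp add: algebra_simps power2_eq_square)
    ultimately show ?thesis unfolding u_def by simp
  qed
  have "mP 4 a \<le> (\<bar>u\<bar> + \<bar>v\<bar>) * (1 + a\<^sup>2)" if "0 \<le> a" for a
  proof -
    have "a \<le> 1 + a\<^sup>2" using sum_squares_bound[of a 1] that by (simp; linarith)
    then have "\<bar>u\<bar> * a \<le> \<bar>u\<bar> * (1 + a\<^sup>2)" by (intro mult_left_mono) auto
    moreover have "u * a \<le> \<bar>u\<bar> * a" using that by (intro mult_right_mono) auto
    moreover have "v * a\<^sup>2 \<le> \<bar>v\<bar> * (1 + a\<^sup>2)" by (intro mult_mono) auto
    ultimately show ?thesis using p4[OF that] by (simp add: distrib_right)
  qed
  then show "\<exists>c\<ge>0. \<forall>a\<ge>0. mP 4 a \<le> c * (1 + a\<^sup>2)"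
    by (intro exI[of _ "\<bar>u\<bar> + \<bar>v\<bar>"]) auto
qed

end

subsection \<open>Integrals of polynomials against the exponential density\<close>

text \<open>Termwise comparison: beyond index \<open>k\<close> the factor
  \<open>c ^ j / c ^ k\<close> is at least 1. For \<open>c > 1\<close> this gains a geometric factor
  in \<open>k\<close>, as in a Chernoff bound.\<close>

lemma exp_taylor_remainder_le:
  fixes x c :: real
  assumes "0 \<le> x" and "1 \<le> c"
  shows "exp x - (\<Sum>j\<le>k. x ^ j / fact j) \<le> exp (c * x) / c ^ k"
proof -
  have s: "(\<lambda>j. y ^ j / fact j) sums exp y" for y :: real
    using exp_converges[of y] by (simp add: divide_inverse mult.commute)
  have "(\<lambda>j. x ^ j / fact j - (if j \<in> {..k} then x ^ j / fact j else 0)) sums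
      (exp x - (\<Sum>j\<le>k. x ^ j / fact j))"
    by (intro sums_diff s sums_If_finite_set) auto
  moreover have "(\<lambda>j. (c * x) ^ j / fact j / c ^ k) sums (exp (c * x) / c ^ k)"
    by (intro sums_divide s)
  ultimately show ?thesis
  proof (rule sums_le[rotated])
    fix j
    show "x ^ j / fact j - (if j \<in> {..k} then x ^ j / fact j else 0) \<le> (c * x) ^ j / fact j / c ^ k"
    proof (cases "j \<le> k")
      case False
      then have "c ^ k \<le> c ^ j" using assms by (intro power_increasing) auto
      then have "x ^ j / fact j * c ^ k \<le> x ^ j / fact j * c ^ j"
        using assms by (intro mult_left_mono) auto
      then have "x ^ j / fact j \<le> x ^ j / fact j * c ^ j / c ^ k"
        using assms by (subst pos_le_divide_eq) auto
      then show ?thesis using False by (simp add: power_mult_distrib mult_ac)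
    qed (use assms in auto)
  qed
qed

lemma absolutely_integrable_scale:
  fixes g :: "real \<Rightarrow> real"
  assumes g: "g absolutely_integrable_on {0..}" and c: "0 < c"
  shows "(\<lambda>t. g (c * t)) absolutely_integrable_on {0..}"
    and "integral {0..} (\<lambda>t. g (c * t)) = integral {0..} g / c"
proof -
  have im: "(\<lambda>t. c * t) ` {0..} = {0..}"
  proof (intro equalityI subsetI)
    fix y :: real assume "y \<in> {0..}"
    then show "y \<in> (\<lambda>t. c * t) ` {0..}" using c by (intro image_eqI[of _ _ "y / c"]) auto
  qed (use c in auto)
  have "(\<lambda>t. \<bar>c\<bar> * g (c * t)) absolutely_integrable_on {0..} \<and>
      integral {0..} (\<lambda>t. \<bar>c\<bar> * g (c * t)) = integral {0..} g"
    using has_absolute_integral_change_of_variables_1'[of "{0..}" "\<lambda>t. c * t" "\<lambda>t. c" g "integral {0..} g"] g c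
    unfolding im by (auto simp: inj_on_def intro!: derivative_eq_intros)
  then have *: "(\<lambda>t. c * g (c * t)) absolutely_integrable_on {0..}"
    "integral {0..} (\<lambda>t. c * g (c * t)) = integral {0..} g" using c by auto
  show "(\<lambda>t. g (c * t)) absolutely_integrable_on {0..}"
    using set_integrable_mult_right[OF *(1), of "1 / c"] set_integrable_mult_right[of "1/c", OF *(1)] c by simp
  show "integral {0..} (\<lambda>t. g (c * t)) = integral {0..} g / c"
    using *(2) c by (simp add: field_simps)
qed

text \<open>The Laplace transform at the point 1, that is the linear functional sending the monomial
  of degree \<open>i\<close> to \<open>i!\<close>. On \<open>real poly\<close> integrability is
  automatic and differentiation algebraic.\<close>

definition laplace :: "real poly \<Rightarrow> real" where
  "laplace p = integral {0..} (\<lambda>s. poly p s * exp (- s))"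

lemma has_integral_power_exp:
  "((\<lambda>s::real. s ^ n * exp (- s)) has_integral fact n) {0..}"
proof -
  have "((\<lambda>t. t powr (real (Suc n) - 1) / exp t) has_integral Gamma (real (Suc n))) {0..}"
    by (rule Gamma_integral_real) simp
  moreover have "Gamma (real (Suc n)) = fact n" using Gamma_fact[of n, where 'a = real] by (simp add: add.commute)
  ultimately have "((\<lambda>t. t powr (real (Suc n) - 1) / exp t) has_integral fact n) {0..}" by simp
  then show ?thesis
    by (rule has_integral_spike_finite[of "{0}", rotated 2]) (auto simp: powr_realpow exp_minus field_simps)
qed

text \<open>On monomials of positive degree the formula is \<open>i! = i * (i - 1)!\<close>, and
  linearity extends it, so no boundary term at infinity has to be estimated. Integrability is
  carried along in \<open>good\<close> because additivity of the integral depends on it.\<close>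

lemma laplace_by_parts:
  "(\<lambda>s. poly p s * exp (- s)) absolutely_integrable_on {0..} \<and>
   laplace p = poly p 0 + laplace (pderiv p)"
proof -
  define good where "good = (\<lambda>p. (\<lambda>s. poly p s * exp (- s)) absolutely_integrable_on {0..} \<and>
    (\<lambda>s. poly (pderiv p) s * exp (- s)) absolutely_integrable_on {0..} \<and>
    laplace p = poly p 0 + laplace (pderiv p))"
  have abs_monom: "(\<lambda>s. poly (monom c i) s * exp (- s)) absolutely_integrable_on {0..}"
    and int_monom: "laplace (monom c i) = c * fact i" for c i
  proof -
    have "(\<lambda>s::real. s ^ i * exp (- s)) absolutely_integrable_on {0..}"
      by (subst absolutely_integrable_on_iff_nonneg) (use has_integral_power_exp[of i] in auto)
    from set_integrable_mult_right[of c, OF this]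
    show "(\<lambda>s. poly (monom c i) s * exp (- s)) absolutely_integrable_on {0..}"
      by (simp add: poly_monom mult.assoc)
    show "laplace (monom c i) = c * fact i"
      using integral_unique[OF has_integral_mult_right[OF has_integral_power_exp[of i], of c]]
      by (simp add: laplace_def poly_monom mult.assoc)
  qed
  have good_monom: "good (monom c i)" for c i
  proof -
    have "laplace (monom c i) = poly (monom c i) 0 + laplace (monom (of_nat i * c) (i - 1))"
      by (cases i) (auto simp: int_monom poly_monom laplace_def[of 0])
    then show ?thesis unfolding good_def pderiv_monom using abs_monom by blast
  qed
  have good_add: "good (p + q)" if "good p" "good q" for p q
  proof -
    have "laplace (p + q) = laplace p + laplace q" 
      if "(\<lambda>s. poly p s * exp (- s)) absolutely_integrable_on {0..}"
        "(\<lambda>s. poly q s * exp (- s)) absolutely_integrable_on {0..}" for p q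
      unfolding laplace_def using that[THEN set_lebesgue_integral_eq_integral(1)]
      by (simp add: distrib_right integral_add)
    then show ?thesis
      using that set_integral_add(1)[of lebesgue "{0..}" "\<lambda>s. poly p s * exp (- s)" "\<lambda>s. poly q s * exp (- s)"]
        set_integral_add(1)[of lebesgue "{0..}" "\<lambda>s. poly (pderiv p) s * exp (- s)" "\<lambda>s. poly (pderiv q) s * exp (- s)"]
      unfolding good_def by (auto simp: pderiv_add distrib_right)
  qed
  have "good (\<Sum>i\<le>n. monom (coeff p i) i)" for n
    by (induction n) (auto intro: good_add good_monom)
  then have "good p" by (metis poly_as_sum_of_monoms)
  then show ?thesis by (auto simp: good_def)
qed

lemmas poly_exp_absolutely_integrable = laplace_by_parts[THEN conjunct1]
lemmas laplace_pderiv = laplace_by_parts[THEN conjunct2]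

lemma laplace_add: "laplace (p + q) = laplace p + laplace q"
  unfolding laplace_def
  using poly_exp_absolutely_integrable[THEN set_lebesgue_integral_eq_integral(1)]
  by (simp add: distrib_right integral_add)

lemma laplace_smult: "laplace (smult c p) = c * laplace p"
  unfolding laplace_def by (simp add: mult.assoc)

text \<open>Each integration by parts contributes one boundary term; the incomplete gamma integral
  thus becomes a partial sum of the exponential series.\<close>

lemma laplace_linear_power:
  "laplace ([:c, 1:] ^ k) / fact k = (\<Sum>j\<le>k. c ^ j / fact j)"
proof (induction k)
  case 0
  have "laplace 1 = 1"
    using laplace_pderiv[of 1] by (simp add: laplace_def)
  then show ?case by simp
next
  case (Suc k)
  have "laplace ([:c, 1:] ^ Suc k) = c ^ Suc k + real (Suc k) * laplace ([:c, 1:] ^ k)"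
    by (subst laplace_pderiv) (simp add: pderiv_power_Suc pderiv_pCons laplace_smult del: power_Suc of_nat_Suc)
  then have "laplace ([:c, 1:] ^ Suc k) / fact (Suc k)
      = c ^ Suc k / fact (Suc k) + laplace ([:c, 1:] ^ k) / fact k"
    by (simp add: add_divide_distrib del: power_Suc of_nat_Suc)
  then show ?case using Suc by simp
qed

subsection \<open>Moments of the normalised basis functions\<close>

context jain
begin

definition shift_poly :: "nat \<Rightarrow> real poly" where "shift_poly k = [:real k * \<beta>, 1:]"
definition center_poly :: "nat \<Rightarrow> real poly" where "center_poly k = [:- (real k * (1 - \<beta>)), 1:]"

definition basis_poly :: "nat \<Rightarrow> real poly" where
  "basis_poly k = (case k of 0 \<Rightarrow> 1
    | Suc m \<Rightarrow> smult (exp (- (real k * \<beta>)) / fact k) ([:0, 1:] * shift_poly k ^ m))"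

lemma P_eq_basis_poly: "P s k = poly (basis_poly k) s * exp (- s)"
proof (cases k)
  case (Suc m)
  have "exp (- (s + real k * \<beta>)) = exp (- (real k * \<beta>)) * exp (- s)" by (simp add: mult_exp_exp)
  then show ?thesis
    unfolding Suc gen_poisson_Suc by (simp add: basis_poly_def shift_poly_def add.commute)
qed (simp add: gen_poisson_0 basis_poly_def)

text \<open>The integral of \<open>Q s k * (s - k (1 - \<beta>)) ^ j\<close> over
  \<open>s \<ge> 0\<close>. In the variable \<open>s + k \<beta>\<close> it is a moment about
  \<open>k\<close> of the Gamma density of shape \<open>k + 1\<close>, cut off below
  \<open>k \<beta>\<close>.\<close>

definition \<gamma> :: "nat \<Rightarrow> nat \<Rightarrow> real" where
  "\<gamma> j k = exp (- (real k * \<beta>)) / fact k * laplace (shift_poly k ^ k * center_poly k ^ j)"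

text \<open>The boundary term at \<open>0\<close> in the integrations by parts.\<close>
definition \<epsilon> :: "nat \<Rightarrow> nat \<Rightarrow> real" where
  "\<epsilon> j k = Q 0 k * (- (real k * (1 - \<beta>))) ^ j"

lemma pderiv_shift_center:
  "pderiv (shift_poly k ^ Suc m * center_poly k ^ j) =
     smult (real (Suc m)) (shift_poly k ^ m * center_poly k ^ j)
     + smult (real j) (shift_poly k ^ Suc m * center_poly k ^ (j - 1))"
proof -
  have s: "pderiv (shift_poly k ^ Suc m) = smult (real (Suc m)) (shift_poly k ^ m)"
    by (simp add: pderiv_power_Suc shift_poly_def pderiv_pCons del: power_Suc of_nat_Suc)
  have c: "pderiv (center_poly k ^ j) = smult (real j) (center_poly k ^ (j - 1))"
    by (cases j) (simp_all add: pderiv_power_Suc center_poly_def pderiv_pCons del: power_Suc of_nat_Suc)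
  show ?thesis unfolding pderiv_mult s c by (simp add: algebra_simps del: power_Suc of_nat_Suc)
qed

lemma laplace_shift_center_Suc:
  "laplace (shift_poly k ^ Suc m * center_poly k ^ j) =
     laplace (shift_poly k ^ m * center_poly k ^ Suc j) + real k * laplace (shift_poly k ^ m * center_poly k ^ j)"
proof -
  have u: "shift_poly k = center_poly k + [:real k:]"
    by (simp add: shift_poly_def center_poly_def algebra_simps)
  have "shift_poly k ^ Suc m * center_poly k ^ j = shift_poly k * (shift_poly k ^ m * center_poly k ^ j)"
    by (simp add: mult_ac)
  also have "\<dots> = center_poly k * (shift_poly k ^ m * center_poly k ^ j)
      + smult (real k) (shift_poly k ^ m * center_poly k ^ j)"
    by (subst u) (simp add: algebra_simps)
  also have "center_poly k * (shift_poly k ^ m * center_poly k ^ j) = shift_poly k ^ m * center_poly k ^ Suc j"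
    by (simp add: mult_ac)
  finally show ?thesis by (simp only: laplace_add laplace_smult)
qed

lemma poly_shift_center_0:
  "exp (- (real k * \<beta>)) / fact k * poly (shift_poly k ^ k * center_poly k ^ j) 0 = \<epsilon> j k"
  by (simp add: shift_poly_def center_poly_def \<epsilon>_def poisson_weight_def mult_ac)

text \<open>The integral of \<open>shift_poly k ^ Suc k * center_poly k ^ j\<close> is computed
  twice, by splitting one factor into \<open>center_poly k\<close> plus \<open>k\<close> and by
  parts. The terms \<open>k * \<gamma> j k\<close> cancel, so a factor \<open>k\<close> appears only
  when the order drops by two. For \<open>j = 0\<close> the truncated \<open>j - 1\<close> is
  multiplied by 0.\<close>

lemma \<gamma>_rec:
  "\<gamma> (Suc j) k = (real j + 1) * \<gamma> j k + real j * real k * \<gamma> (j - 1) k + real k * \<beta> * \<epsilon> j k"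
proof -
  let ?L = "\<lambda>m j. laplace (shift_poly k ^ m * center_poly k ^ j)"
  have "?L k (Suc j) + real k * ?L k j = ?L (Suc k) j" by (simp only: laplace_shift_center_Suc)
  also have "\<dots> = real k * \<beta> * poly (shift_poly k ^ k * center_poly k ^ j) 0
      + (real (Suc k) * ?L k j + real j * ?L (Suc k) (j - 1))"
    by (subst laplace_pderiv, subst pderiv_shift_center)
       (simp add: laplace_add laplace_smult shift_poly_def mult.assoc del: power_Suc of_nat_Suc,
        simp add: mult_ac)
  also have "real j * ?L (Suc k) (j - 1) = real j * ?L k j + real j * real k * ?L k (j - 1)"
    by (cases j) (simp_all only: laplace_shift_center_Suc diff_Suc_1, simp_all add: algebra_simps)
  finally have L: "?L k (Suc j) = (real j + 1) * ?L k j + real j * real k * ?L k (j - 1)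
      + real k * \<beta> * poly (shift_poly k ^ k * center_poly k ^ j) 0" by (simp add: algebra_simps)
  define c where "c = exp (- (real k * \<beta>)) / fact k"
  show ?thesis
    unfolding \<gamma>_def poly_shift_center_0[symmetric] c_def[symmetric] L by (simp only: algebra_simps)
qed

definition J :: "nat \<Rightarrow> nat \<Rightarrow> real" where
  "J j k = laplace (basis_poly k * center_poly k ^ j)"

text \<open>The factor \<open>s\<close> of the basis function is
  \<open>(s + k \<beta>) - k \<beta>\<close>, and integration by parts restores the exponent
  \<open>k\<close> in the second part. At \<open>k = 0\<close> the basis polynomial is 1, and
  \<open>center_poly k ^ j\<close> itself is integrated by parts.\<close>

lemma J_eq: "J j k = (1 - \<beta>) * \<gamma> j k + \<beta> * \<epsilon> j k + \<beta> * real j * \<gamma> (j - 1) k"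
proof (cases k)
  case 0
  have \<epsilon>: "\<epsilon> j k = poly (center_poly k ^ j) 0" by (simp add: 0 \<epsilon>_def center_poly_def poisson_weight_def)
  have "laplace (center_poly k ^ j) = poly (center_poly k ^ j) 0 + real j * laplace (center_poly k ^ (j - 1))"
    using laplace_pderiv[of "center_poly k ^ j"]
    by (cases j) (simp_all add: pderiv_power_Suc center_poly_def pderiv_pCons laplace_smult del: power_Suc of_nat_Suc,
      simp_all add: laplace_def)
  then show ?thesis
    unfolding \<epsilon> by (simp add: 0 J_def \<gamma>_def basis_poly_def algebra_simps)
next
  case (Suc m)
  let ?L = "\<lambda>m j. laplace (shift_poly k ^ m * center_poly k ^ j)"
  let ?c = "exp (- (real k * \<beta>)) / fact k"
  have z: "[:0, 1:] = shift_poly k + smult (- (real k * \<beta>)) 1" by (simp add: shift_poly_def)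
  have "basis_poly k * center_poly k ^ j = smult ?c ([:0, 1:] * (shift_poly k ^ m * center_poly k ^ j))"
    by (simp add: basis_poly_def Suc mult.assoc)
  also have "\<dots> = smult ?c (shift_poly k ^ k * center_poly k ^ j
      + smult (- (real k * \<beta>)) (shift_poly k ^ m * center_poly k ^ j))"
    by (subst z) (simp add: Suc distrib_right mult.assoc)
  finally have "J j k = ?c * (?L k j - \<beta> * (real k * ?L m j))"
    unfolding J_def by (simp only: laplace_add laplace_smult) (simp add: mult_ac)
  also have "real k * ?L m j = ?L k j - poly (shift_poly k ^ k * center_poly k ^ j) 0 - real j * ?L k (j - 1)"
  proof -
    have "?L (Suc m) j = poly (shift_poly k ^ Suc m * center_poly k ^ j) 0
        + (real (Suc m) * ?L m j + real j * ?L (Suc m) (j - 1))"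
      by (subst laplace_pderiv) (simp only: pderiv_shift_center laplace_add laplace_smult)
    then show ?thesis by (simp only: Suc)
  qed
  finally have L: "J j k = ?c * (?L k j - \<beta> *
      (?L k j - poly (shift_poly k ^ k * center_poly k ^ j) 0 - real j * ?L k (j - 1)))" .
  define c where "c = ?c"
  show ?thesis
    unfolding \<gamma>_def poly_shift_center_0[symmetric] L c_def[symmetric] by (simp only: algebra_simps)
qed

text \<open>By \<open>laplace_linear_power\<close>, \<open>\<gamma> 0 k\<close> is the probability
  that a Poisson variable of mean \<open>k \<beta>\<close> is at most \<open>k\<close>. As
  \<open>\<beta> < 1\<close>, exceeding \<open>k\<close> is a large deviation, and
  \<open>exp_taylor_remainder_le\<close> with \<open>c = 1 + \<eta>\<close> bounds it by
  \<open>r ^ k\<close>.\<close>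

lemma \<gamma>_0_bounds:
  obtains r where "0 < r" "r < 1" "\<And>k. 0 < \<gamma> 0 k" "\<And>k. \<gamma> 0 k \<le> 1" "\<And>k. 1 - r ^ k \<le> \<gamma> 0 k"
proof -
  obtain \<eta> r where r: "0 < \<eta>" "0 < r" "r < 1" "exp (\<eta> * \<beta>) = (1 + \<eta>) * r"
    by (rule chernoff_rate)
  have \<gamma>: "\<gamma> 0 k = exp (- (real k * \<beta>)) * (\<Sum>j\<le>k. (real k * \<beta>) ^ j / fact j)" for k
  proof -
    have "\<gamma> 0 k = exp (- (real k * \<beta>)) * (laplace ([:real k * \<beta>, 1:] ^ k) / fact k)"
      by (simp add: \<gamma>_def shift_poly_def)
    then show ?thesis by (simp only: laplace_linear_power)
  qed
  show ?thesis
  proof (rule that[OF r(2,3)])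
    fix k
    let ?c = "real k * \<beta>"
    have c: "0 \<le> ?c" using \<beta>_nonneg by simp
    have "0 < (\<Sum>j\<le>k. ?c ^ j / fact j)"
      by (rule sum_pos2[of _ 0]) (use c in auto)
    then show "0 < \<gamma> 0 k" by (simp add: \<gamma>)
    have "(\<Sum>j\<le>k. ?c ^ j / fact j) \<le> (\<Sum>j. ?c ^ j / fact j)"
      using exp_converges[of ?c] c
      by (intro sum_le_suminf) (auto simp: sums_iff divide_inverse mult.commute)
    also have "\<dots> = exp ?c" using exp_converges[of ?c] by (simp add: sums_iff divide_inverse mult.commute)
    finally have "exp (- ?c) * (\<Sum>j\<le>k. ?c ^ j / fact j) \<le> exp (- ?c) * exp ?c"
      by (intro mult_left_mono) auto
    then show "\<gamma> 0 k \<le> 1" by (simp add: \<gamma> mult_exp_exp)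
    have "exp (- ?c) * (exp ?c - (\<Sum>j\<le>k. ?c ^ j / fact j)) \<le> exp (- ?c) * (exp ((1 + \<eta>) * ?c) / (1 + \<eta>) ^ k)"
      using c r by (intro mult_left_mono exp_taylor_remainder_le) auto
    also have "\<dots> = exp (\<eta> * ?c) / (1 + \<eta>) ^ k" by (simp add: mult_exp_exp algebra_simps)
    also have "exp (\<eta> * ?c) = exp (\<eta> * \<beta>) ^ k" by (simp add: exp_of_nat_mult[symmetric] mult_ac)
    also have "\<dots> = ((1 + \<eta>) * r) ^ k" by (simp only: r(4))
    also have "\<dots> / (1 + \<eta>) ^ k = r ^ k" using r by (simp add: power_mult_distrib)
    finally have "1 - \<gamma> 0 k \<le> r ^ k" by (simp add: \<gamma> right_diff_distrib mult_exp_exp)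
    then show "1 - r ^ k \<le> \<gamma> 0 k" by simp
  qed
qed

lemma \<gamma>_0_tendsto: "\<gamma> 0 \<longlonglongrightarrow> 1"
proof -
  obtain r where r: "0 < r" "r < 1" "\<And>k. \<gamma> 0 k \<le> 1" "\<And>k. 1 - r ^ k \<le> \<gamma> 0 k"
    by (rule \<gamma>_0_bounds) blast
  have "(\<lambda>k. 1 - r ^ k) \<longlonglongrightarrow> 1 - 0" using r by (intro tendsto_intros LIMSEQ_realpow_zero) auto
  then show ?thesis
    by (intro tendsto_sandwich[of "\<lambda>k. 1 - r ^ k" "\<gamma> 0" _ "\<lambda>_. 1"]) (use r in auto)
qed

text \<open>A sequence of polynomial growth times \<open>Q 0 k\<close> is the general term of a
  convergent series.\<close>

lemma \<epsilon>_tendsto: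
  assumes "poly_bounded \<phi>"
  shows "(\<lambda>k. \<phi> k * \<epsilon> j k) \<longlonglongrightarrow> 0"
proof -
  have "poly_bounded (\<lambda>k. \<phi> k * (- (real k * (1 - \<beta>))) ^ j)"
    using assms by (intro poly_bounded_mult poly_bounded_power poly_bounded_minus) auto
  from summable_LIMSEQ_zero[OF summable_Q[OF this order_refl]]
  show ?thesis by (simp add: \<epsilon>_def mult_ac)
qed

lemma J_0_pos: "0 < J 0 k"
proof -
  have "0 < \<gamma> 0 k" by (rule \<gamma>_0_bounds) blast
  moreover have "0 \<le> \<epsilon> 0 k" using Q_nonneg[of 0] by (simp add: \<epsilon>_def)
  ultimately show ?thesis using \<beta>_nonneg \<beta>_less_1 by (simp add: J_eq add_pos_nonneg)
qed

definition M :: "nat \<Rightarrow> nat \<Rightarrow> real" where "M j k = J j k / J 0 k"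

lemma \<gamma>_1_tendsto: "\<gamma> 1 \<longlonglongrightarrow> 1"
proof -
  have "\<gamma> 1 = (\<lambda>k. \<gamma> 0 k + (real k * \<beta>) * \<epsilon> 0 k)"
    by (rule ext) (use \<gamma>_rec[of 0] in simp)
  moreover have "(\<lambda>k. \<gamma> 0 k + (real k * \<beta>) * \<epsilon> 0 k) \<longlonglongrightarrow> 1 + 0"
    by (intro tendsto_add \<gamma>_0_tendsto \<epsilon>_tendsto) auto
  ultimately show ?thesis by simp
qed

lemma \<gamma>_2: "\<gamma> 2 k = 2 * \<gamma> 1 k + real k * \<gamma> 0 k + real k * \<beta> * \<epsilon> 1 k"
  using \<gamma>_rec[of 1 k] by (simp add: numeral_2_eq_2)

lemma \<gamma>_3: "\<gamma> 3 k = 3 * \<gamma> 2 k + 2 * real k * \<gamma> 1 k + real k * \<beta> * \<epsilon> 2 k"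
  using \<gamma>_rec[of 2 k] by (simp add: numeral_3_eq_3 numeral_2_eq_2)

lemma \<gamma>_4: "\<gamma> 4 k = 4 * \<gamma> 3 k + 3 * real k * \<gamma> 2 k + real k * \<beta> * \<epsilon> 3 k"
  using \<gamma>_rec[of 3 k] by (simp add: eval_nat_numeral)

lemma J_0_tendsto: "J 0 \<longlonglongrightarrow> 1 - \<beta>"
proof -
  have "(\<lambda>k. (1 - \<beta>) * \<gamma> 0 k + \<beta> * \<epsilon> 0 k) \<longlonglongrightarrow> (1 - \<beta>) * 1 + 0"
    by (intro tendsto_add tendsto_mult_left \<gamma>_0_tendsto \<epsilon>_tendsto) auto
  then show ?thesis by (simp add: J_eq[abs_def])
qed

lemma M_1_tendsto: "M 1 \<longlonglongrightarrow> 1 / (1 - \<beta>)"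
proof -
  have "(\<lambda>k. (1 - \<beta>) * \<gamma> 1 k + \<beta> * \<epsilon> 1 k + \<beta> * \<gamma> 0 k) \<longlonglongrightarrow> (1 - \<beta>) * 1 + 0 + \<beta> * 1"
    by (intro tendsto_add tendsto_mult_left \<gamma>_0_tendsto \<gamma>_1_tendsto \<epsilon>_tendsto) auto
  then have "J 1 \<longlonglongrightarrow> 1" by (simp add: J_eq[abs_def])
  then show ?thesis
    unfolding M_def[abs_def] using \<beta>_less_1 by (intro tendsto_divide J_0_tendsto) auto
qed

text \<open>\<open>J 2 k\<close> and \<open>k * J 0 k\<close> share their unbounded part
  \<open>(1 - \<beta>) * k * \<gamma> 0 k\<close>. What is left tends to
  \<open>2 (1 - \<beta>) + 2 \<beta> = 2\<close> and is divided by \<open>J 0 k\<close>, which tends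
  to \<open>1 - \<beta>\<close>.\<close>

lemma M_2_tendsto: "(\<lambda>k. M 2 k - real k) \<longlonglongrightarrow> 2 / (1 - \<beta>)"
proof -
  have "(\<lambda>k. (1 - \<beta>) * (2 * \<gamma> 1 k + real k * \<beta> * \<epsilon> 1 k) + \<beta> * \<epsilon> 2 k + 2 * \<beta> * \<gamma> 1 k - real k * \<beta> * \<epsilon> 0 k)
     \<longlonglongrightarrow> (1 - \<beta>) * (2 * 1 + 0) + 0 + 2 * \<beta> * 1 - 0"
    by (intro tendsto_add tendsto_diff tendsto_mult_left \<gamma>_1_tendsto \<epsilon>_tendsto) auto
  also have "(\<lambda>k. (1 - \<beta>) * (2 * \<gamma> 1 k + real k * \<beta> * \<epsilon> 1 k) + \<beta> * \<epsilon> 2 k + 2 * \<beta> * \<gamma> 1 k - real k * \<beta> * \<epsilon> 0 k)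
     = (\<lambda>k. J 2 k - real k * J 0 k)"
    by (rule ext) (simp add: J_eq \<gamma>_2 algebra_simps)
  finally have "(\<lambda>k. (J 2 k - real k * J 0 k) / J 0 k) \<longlonglongrightarrow> 2 / (1 - \<beta>)"
    using \<beta>_less_1 by (intro tendsto_divide J_0_tendsto) (auto simp: algebra_simps)
  moreover have "(J 2 k - real k * J 0 k) / J 0 k = M 2 k - real k" for k
    using J_0_pos[of k] by (simp add: M_def field_simps)
  ultimately show ?thesis by simp
qed

text \<open>The growth is quadratic and not quartic because \<open>\<gamma>_rec\<close> spends two
  orders for each factor \<open>k\<close>.\<close>

lemma M_4_bound: "\<exists>C\<ge>0. \<forall>k. M 4 k \<le> C * (1 + (real k)\<^sup>2)"
proof -
  obtain G0 where G0: "\<And>k. \<bar>\<gamma> 0 k\<bar> \<le> G0" using tendsto_imp_abs_bounded[OF \<gamma>_0_tendsto] by blast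
  obtain G1 where G1: "\<And>k. \<bar>\<gamma> 1 k\<bar> \<le> G1" using tendsto_imp_abs_bounded[OF \<gamma>_1_tendsto] by blast
  have e: "(\<lambda>k. real k * \<beta> * \<epsilon> j k) \<longlonglongrightarrow> 0" for j
    by (rule \<epsilon>_tendsto) auto
  obtain E1 where E1: "\<And>k. \<bar>real k * \<beta> * \<epsilon> 1 k\<bar> \<le> E1" using tendsto_imp_abs_bounded[OF e[of 1]] by blast
  obtain E2 where E2: "\<And>k. \<bar>real k * \<beta> * \<epsilon> 2 k\<bar> \<le> E2" using tendsto_imp_abs_bounded[OF e[of 2]] by blast
  obtain E3 where E3: "\<And>k. \<bar>real k * \<beta> * \<epsilon> 3 k\<bar> \<le> E3" using tendsto_imp_abs_bounded[OF e[of 3]] by blast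
  obtain E4 where E4: "\<And>k. \<bar>1 * \<epsilon> 4 k\<bar> \<le> E4" using tendsto_imp_abs_bounded[OF \<epsilon>_tendsto[of "\<lambda>k. 1" 4]] by blast
  have "(\<lambda>k. inverse (J 0 k)) \<longlonglongrightarrow> inverse (1 - \<beta>)"
    using \<beta>_less_1 by (intro tendsto_inverse J_0_tendsto) auto
  then obtain I where I: "\<And>k. \<bar>inverse (J 0 k)\<bar> \<le> I" using tendsto_imp_abs_bounded by blast
  define G where "G = 1 + \<bar>G0\<bar> + \<bar>G1\<bar> + \<bar>E1\<bar> + \<bar>E2\<bar> + \<bar>E3\<bar> + \<bar>E4\<bar>"
  have G: "1 \<le> G" "G0 \<le> G" "G1 \<le> G" "E1 \<le> G" "E2 \<le> G" "E3 \<le> G" "E4 \<le> G"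
    unfolding G_def by linarith+
  \<comment> \<open>The constants below: 4 = 2 + 1 + 1 for \<open>\<gamma> 2\<close>, 15 = 3 * 4 + 2
    + 1 for \<open>\<gamma> 3\<close>, 73 = 4 * 15 + 3 * 4 + 1 for \<open>\<gamma> 4\<close>; then
    73 + 1 + 4 * 15 = 134 is rounded up to 200.\<close>
  have J4: "\<bar>J 4 k\<bar> \<le> 200 * G * (real k + 1)\<^sup>2" for k
  proof -
    define K where "K = real k + 1"
    have K: "1 \<le> K" "real k \<le> K" by (auto simp: K_def)
    have GK: "G \<le> G * K" "G * K \<le> G * K\<^sup>2" "real k * G \<le> G * K"
      using G(1) K by (auto simp: power2_eq_square mult_ac)
    have "\<bar>real k * \<gamma> 0 k\<bar> \<le> G * K"
      using GK(3) mult_left_mono[OF order_trans[OF G0[of k] G(2)], of "real k"] by (simp add: abs_mult)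
    then have 2: "\<bar>\<gamma> 2 k\<bar> \<le> 4 * (G * K)"
      unfolding \<gamma>_2 using G1[of k] E1[of k] G GK by linarith
    have "\<bar>real k * \<gamma> 1 k\<bar> \<le> G * K"
      using GK(3) mult_left_mono[OF order_trans[OF G1[of k] G(3)], of "real k"] by (simp add: abs_mult)
    then have 3: "\<bar>\<gamma> 3 k\<bar> \<le> 15 * (G * K)"
      unfolding \<gamma>_3 using 2 E2[of k] G GK by linarith
    have "\<bar>real k * \<gamma> 2 k\<bar> \<le> K * (4 * (G * K))"
      unfolding abs_mult using 2 K by (intro mult_mono) auto
    then have "\<bar>real k * \<gamma> 2 k\<bar> \<le> 4 * (G * K\<^sup>2)" by (simp add: power2_eq_square mult_ac)
    then have 4: "\<bar>\<gamma> 4 k\<bar> \<le> 73 * (G * K\<^sup>2)"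
      unfolding \<gamma>_4 using 3 E3[of k] G GK by linarith
    have b: "\<bar>(1 - \<beta>) * y\<bar> \<le> \<bar>y\<bar>" "\<bar>\<beta> * y\<bar> \<le> \<bar>y\<bar>" for y
      using \<beta>_nonneg \<beta>_less_1 by (auto simp: abs_mult intro: mult_left_le_one_le)
    have "J 4 k = (1 - \<beta>) * \<gamma> 4 k + \<beta> * \<epsilon> 4 k + 4 * (\<beta> * \<gamma> 3 k)" by (simp add: J_eq)
    moreover have "\<bar>p + q + 4 * r\<bar> \<le> \<bar>p\<bar> + \<bar>q\<bar> + 4 * \<bar>r\<bar>" for p q r :: real by linarith
    ultimately have "\<bar>J 4 k\<bar> \<le> \<bar>(1 - \<beta>) * \<gamma> 4 k\<bar> + \<bar>\<beta> * \<epsilon> 4 k\<bar> + 4 * \<bar>\<beta> * \<gamma> 3 k\<bar>" by metis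
    also have "\<dots> \<le> \<bar>\<gamma> 4 k\<bar> + \<bar>\<epsilon> 4 k\<bar> + 4 * \<bar>\<gamma> 3 k\<bar>"
      by (intro add_mono mult_left_mono b) auto
    also have "\<bar>\<epsilon> 4 k\<bar> \<le> G * K\<^sup>2"
    proof -
      have "\<bar>\<epsilon> 4 k\<bar> \<le> G" using E4[of k] G(7) by simp
      also have "\<dots> \<le> G * K\<^sup>2" by (rule order_trans[OF GK(1,2)])
      finally show ?thesis .
    qed
    also have "\<bar>\<gamma> 3 k\<bar> \<le> 15 * (G * K\<^sup>2)" using 3 GK(2) by linarith
    finally have "\<bar>J 4 k\<bar> \<le> 73 * (G * K\<^sup>2) + G * K\<^sup>2 + 60 * (G * K\<^sup>2)" using 4 by linarith
    moreover have "0 \<le> G * K\<^sup>2" using G(1) by simp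
    ultimately show ?thesis unfolding K_def[symmetric] by simp
  qed
  have I0: "0 \<le> I" using I[of 0] by linarith
  have "M 4 k \<le> 400 * G * I * (1 + (real k)\<^sup>2)" for k
  proof -
    have "M 4 k \<le> \<bar>J 4 k\<bar> * \<bar>inverse (J 0 k)\<bar>"
      using abs_ge_self[of "M 4 k"] by (simp add: M_def divide_inverse abs_mult)
    also have "\<dots> \<le> 200 * G * (real k + 1)\<^sup>2 * I"
      using J4[of k] I[of k] by (intro mult_mono) (use G(1) in auto)
    also have "\<dots> \<le> 200 * G * (2 * (1 + (real k)\<^sup>2)) * I"
      using sum_squares_bound[of "real k" 1] G(1) I0
      by (intro mult_right_mono mult_left_mono) (auto simp: power2_sum)
    finally show ?thesis by (simp add: mult_ac)
  qed
  then show ?thesis using G(1) I0 by (intro exI[of _ "400 * G * I"]) auto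
qed

end

subsection \<open>Taylor expansion of the operator\<close>

text \<open>Near \<open>x\<close> the remainder has derivative
  \<open>f' y - f' x - f'' * (y - x)\<close>, small against \<open>y - x\<close> by
  differentiability of \<open>f'\<close> at \<open>x\<close> alone. Far from \<open>x\<close> only
  boundedness of \<open>f\<close> helps, and the quartic term absorbs everything, with
  \<open>C\<close> depending on \<open>e\<close>.\<close>

lemma taylor_2_global_bound:
  fixes f f' :: "real \<Rightarrow> real" and f'' x e :: real
  assumes bdd: "bounded (f ` {0..})" and x: "0 \<le> x"
    and df: "\<forall>\<^sub>F y in nhds x. 0 \<le> y \<longrightarrow> (f has_real_derivative f' y) (at y within {0..})"
    and df': "(f' has_real_derivative f'') (at x within {0..})"
    and e: "0 < e"
  shows "\<exists>C\<ge>0. \<forall>t\<ge>0. \<bar>f t - f x - f' x * (t - x) - f'' / 2 * (t - x)\<^sup>2\<bar>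
           \<le> e * (t - x)\<^sup>2 + C * (t - x) ^ 4"
proof -
  define r where "r = (\<lambda>t. f t - f x - f' x * (t - x) - f'' / 2 * (t - x)\<^sup>2)"
  from df obtain d1 where d1: "0 < d1"
    "\<And>y. dist y x < d1 \<Longrightarrow> 0 \<le> y \<Longrightarrow> (f has_real_derivative f' y) (at y within {0..})"
    unfolding eventually_nhds_metric by blast
  from df' e obtain d2 where d2: "0 < d2"
    "\<And>y. 0 \<le> y \<Longrightarrow> \<bar>y - x\<bar> < d2 \<Longrightarrow> \<bar>f' y - f' x - f'' * (y - x)\<bar> \<le> e * \<bar>y - x\<bar>"
    unfolding has_field_derivative_def has_derivative_within_alt by auto
  define d where "d = min d1 d2"
  have d: "0 < d" using d1(1) d2(1) by (simp add: d_def)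
  have near: "\<bar>r t\<bar> \<le> e * (t - x)\<^sup>2" if t: "0 \<le> t" "\<bar>t - x\<bar> < d" for t
  proof -
    have S: "0 \<le> y \<and> \<bar>y - x\<bar> \<le> \<bar>t - x\<bar>" if "y \<in> closed_segment x t" for y
      using that t x by (auto simp: closed_segment_eq_real_ivl split: if_splits)
    have "norm (r t - r x) \<le> e * \<bar>t - x\<bar> * norm (t - x)"
    proof (rule field_differentiable_bound[of "closed_segment x t" r "\<lambda>y. f' y - f' x - f'' * (y - x)"])
      fix y assume y: "y \<in> closed_segment x t"
      then have y': "0 \<le> y" "\<bar>y - x\<bar> < d" using S t by force+
      have "(f has_real_derivative f' y) (at y within {0..})"
        using y' by (intro d1(2)) (auto simp: dist_real_def d_def)
      then have "(f has_real_derivative f' y) (at y within closed_segment x t)"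
        by (rule has_field_derivative_subset) (use S in auto)
      then show "(r has_real_derivative f' y - f' x - f'' * (y - x)) (at y within closed_segment x t)"
        unfolding r_def by (auto intro!: derivative_eq_intros)
      have "\<bar>f' y - f' x - f'' * (y - x)\<bar> \<le> e * \<bar>y - x\<bar>"
        using y' by (intro d2(2)) (auto simp: d_def)
      also have "\<dots> \<le> e * \<bar>t - x\<bar>" using S[OF y] e by (intro mult_left_mono) auto
      finally show "norm (f' y - f' x - f'' * (y - x)) \<le> e * \<bar>t - x\<bar>" by simp
    qed auto
    moreover have "r x = 0" by (simp add: r_def)
    ultimately show ?thesis by (simp add: power2_eq_square mult.assoc)
  qed
  obtain F where F: "\<And>t. 0 \<le> t \<Longrightarrow> \<bar>f t\<bar> \<le> F" using bdd unfolding bounded_iff by auto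
  have F0: "0 \<le> F" using F[of 0] by simp
  \<comment> \<open>One summand for each of \<open>1 \<le> (h / d) ^ 4\<close>,
    \<open>h \<le> h ^ 4 / d ^ 3\<close> and \<open>h ^ 2 \<le> h ^ 4 / d ^ 2\<close>, valid for
    \<open>h \<ge> d\<close>.\<close>
  define C where "C = 2 * F / d ^ 4 + \<bar>f' x\<bar> / d ^ 3 + \<bar>f'' / 2\<bar> / d\<^sup>2"
  have C: "0 \<le> C" using F0 d by (simp add: C_def)
  have far: "\<bar>r t\<bar> \<le> C * (t - x) ^ 4" if t: "0 \<le> t" "d \<le> \<bar>t - x\<bar>" for t
  proof -
    define h where "h = \<bar>t - x\<bar>"
    have h: "d \<le> h" "0 \<le> h" using t by (auto simp: h_def)
    have "\<bar>r t\<bar> \<le> \<bar>f t\<bar> + \<bar>f x\<bar> + \<bar>f' x * (t - x)\<bar> + \<bar>f'' / 2 * (t - x)\<^sup>2\<bar>"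
      unfolding r_def by linarith
    also have "\<dots> \<le> 2 * F + \<bar>f' x\<bar> * h + \<bar>f'' / 2\<bar> * h\<^sup>2"
      using F[OF t(1)] F[OF x] by (simp add: abs_mult h_def)
    also have "2 * F \<le> 2 * F / d ^ 4 * h ^ 4"
      using F0 d h mult_left_mono[OF power_mono[OF h(1), of 4], of "2 * F"] by (simp add: field_simps)
    also have "\<bar>f' x\<bar> * h \<le> \<bar>f' x\<bar> / d ^ 3 * h ^ 4"
      using d h mult_left_mono[OF power_mono[OF h(1), of 3], of "\<bar>f' x\<bar> * h"]
      by (simp add: field_simps eval_nat_numeral)
    also have "\<bar>f'' / 2\<bar> * h\<^sup>2 \<le> \<bar>f'' / 2\<bar> / d\<^sup>2 * h ^ 4"
      using d h mult_left_mono[OF power_mono[OF h(1), of 2], of "\<bar>f'' / 2\<bar> * h\<^sup>2"]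
      by (simp add: field_simps eval_nat_numeral)
    finally show ?thesis by (simp add: C_def h_def distrib_right)
  qed
  have "\<bar>r t\<bar> \<le> e * (t - x)\<^sup>2 + C * (t - x) ^ 4" if "0 \<le> t" for t
  proof (cases "\<bar>t - x\<bar> < d")
    case True
    then have "\<bar>r t\<bar> \<le> e * (t - x)\<^sup>2" using near that by blast
    moreover have "0 \<le> C * (t - x) ^ 4" using C by simp
    ultimately show ?thesis by linarith
  next
    case False
    then have "\<bar>r t\<bar> \<le> C * (t - x) ^ 4" using far that by simp
    moreover have "0 \<le> e * (t - x)\<^sup>2" using e by simp
    ultimately show ?thesis by linarith
  qed
  then show ?thesis using C unfolding r_def by blast
qed

text \<open>The weight \<open>v\<close> of the arbitrary \<open>e\<close> stays bounded, and
  \<open>C\<close> may depend on \<open>e\<close> because its weight \<open>w\<close> vanishes in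
  the limit.\<close>

lemma tendsto_if_epsilon_close:
  fixes X Z v w :: "nat \<Rightarrow> real"
  assumes close: "\<And>e. 0 < e \<Longrightarrow> \<exists>C. \<forall>n>0. \<bar>X n - Z n\<bar> \<le> e * v n + C * w n"
    and v: "v \<longlonglongrightarrow> V" and w: "w \<longlonglongrightarrow> 0" and Z: "Z \<longlonglongrightarrow> L"
  shows "X \<longlonglongrightarrow> L"
proof -
  have "(\<lambda>n. X n - Z n) \<longlonglongrightarrow> 0"
  proof (rule tendstoI)
    fix \<delta> :: real assume \<delta>: "0 < \<delta>"
    define e where "e = \<delta> / (2 * (\<bar>V\<bar> + 1))"
    have e: "0 < e" "e * (\<bar>V\<bar> + 1) = \<delta> / 2" using \<delta> by (auto simp: e_def field_simps)
    from close[OF e(1)] obtain C where C: "\<And>n. 0 < n \<Longrightarrow> \<bar>X n - Z n\<bar> \<le> e * v n + C * w n" by blast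
    have "(\<lambda>n. C * w n) \<longlonglongrightarrow> C * 0" by (intro tendsto_intros w)
    then have "\<forall>\<^sub>F n in sequentially. C * w n < \<delta> / 2" using \<delta> by (intro order_tendstoD(2)) auto
    moreover have "\<forall>\<^sub>F n in sequentially. v n < \<bar>V\<bar> + 1" using v by (rule order_tendstoD(2)) auto
    ultimately show "\<forall>\<^sub>F n in sequentially. dist (X n - Z n) 0 < \<delta>"
      using eventually_gt_at_top[of 0]
    proof eventually_elim
      case (elim n)
      have "e * v n \<le> e * (\<bar>V\<bar> + 1)" using elim(2) e(1) by (intro mult_left_mono) auto
      then show ?case using C[of n] elim e(2) by (simp add: dist_real_def)
    qed
  qed
  from tendsto_add[OF this Z] show ?thesis by simp
qed

lemma inverse_sqrt_tendsto_0: "(\<lambda>n. 1 / sqrt (real n)) \<longlonglongrightarrow> 0"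
  using tendsto_inverse_0_at_top[OF filterlim_compose[OF sqrt_at_top filterlim_real_sequentially]]
  by (simp add: divide_inverse)

context jain
begin

text \<open>The conditional expectation of \<open>poly p s\<close> given \<open>k\<close>, for the
  density \<open>P s k / J 0 k\<close> on \<open>s \<ge> 0\<close>.\<close>

definition mean :: "nat \<Rightarrow> real poly \<Rightarrow> real" where
  "mean k p = laplace (basis_poly k * p) / J 0 k"

lemma mean_add: "mean k (p + q) = mean k p + mean k q"
  by (simp add: mean_def distrib_left laplace_add add_divide_distrib)

lemma mean_smult: "mean k (smult c p) = c * mean k p"
  by (simp add: mean_def laplace_smult)

lemma mean_1: "mean k 1 = 1"
  using J_0_pos[of k] by (simp add: mean_def J_def)

lemma mean_center: "mean k (center_poly k ^ j) = M j k"
  by (simp add: mean_def M_def J_def)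

lemma mean_mono:
  assumes "\<And>s. 0 \<le> s \<Longrightarrow> poly p s \<le> poly q s"
  shows "mean k p \<le> mean k q"
proof -
  have "laplace (basis_poly k * p) \<le> laplace (basis_poly k * q)"
    unfolding laplace_def
  proof (rule integral_le)
    show "(\<lambda>s. poly (basis_poly k * p) s * exp (- s)) integrable_on {0..}"
      "(\<lambda>s. poly (basis_poly k * q) s * exp (- s)) integrable_on {0..}"
      by (rule set_lebesgue_integral_eq_integral(1)[OF poly_exp_absolutely_integrable])+
    fix s :: real assume "s \<in> {0..}"
    then have "P s k * poly p s \<le> P s k * poly q s" using assms P_nonneg by (intro mult_left_mono) auto
    then show "poly (basis_poly k * p) s * exp (- s) \<le> poly (basis_poly k * q) s * exp (- s)"
      by (simp add: P_eq_basis_poly mult_ac)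
  qed
  then show ?thesis unfolding mean_def using J_0_pos[of k] by (simp add: divide_right_mono)
qed

text \<open>\<open>U\<close> and \<open>V\<close> are the exact first and second conditional moments
  of \<open>s - a\<close>. \<open>W\<close> only bounds the fourth, through
  \<open>(z + y) ^ 4 \<le> 8 * (z ^ 4 + y ^ 4)\<close>, which avoids mixed terms such as
  \<open>Y a k * M 3 k\<close>.\<close>

definition U :: "real \<Rightarrow> nat \<Rightarrow> real" where "U a k = M 1 k + Y a k"
definition V :: "real \<Rightarrow> nat \<Rightarrow> real" where "V a k = M 2 k + 2 * (Y a k * M 1 k) + Y a k ^ 2"
definition W :: "real \<Rightarrow> nat \<Rightarrow> real" where "W a k = 8 * (M 4 k + Y a k ^ 4)"

lemma mean_shifted:
  shows "mean k [:- a, 1:] = U a k"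
    and "mean k ([:- a, 1:] ^ 2) = V a k"
    and "mean k ([:- a, 1:] ^ 4) \<le> W a k"
proof -
  have c: "[:- a, 1:] = center_poly k + smult (Y a k) 1" by (simp add: center_poly_def Y_def)
  show "mean k [:- a, 1:] = U a k"
    using mean_center[of k 1] unfolding c U_def mean_add mean_smult mean_1 by simp
  have "[:- a, 1:] ^ 2 = center_poly k ^ 2 + smult (2 * Y a k) (center_poly k ^ 1) + smult (Y a k ^ 2) 1"
    by (rule poly_eq_poly_eq_iff[THEN iffD1], rule ext)
       (simp add: center_poly_def Y_def power2_eq_square algebra_simps)
  then show "mean k ([:- a, 1:] ^ 2) = V a k"
    unfolding V_def by (simp only: mean_add mean_smult mean_center mean_1 mult_1_right mult.assoc)
  have "mean k ([:- a, 1:] ^ 4) \<le> mean k (smult 8 (center_poly k ^ 4 + smult (Y a k ^ 4) 1))"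
  proof (rule mean_mono)
    fix s
    define z y where "z = poly (center_poly k) s" and "y = Y a k"
    have *: "(p + q) ^ 2 \<le> 2 * (p ^ 2 + q ^ 2)" for p q :: real
      using sum_squares_bound[of p q] by (simp add: power2_sum)
    have "((z + y) ^ 2) ^ 2 \<le> (2 * (z ^ 2 + y ^ 2)) ^ 2" by (intro power_mono *) auto
    also have "\<dots> = 4 * (z ^ 2 + y ^ 2) ^ 2" unfolding power_mult_distrib by simp
    also have "\<dots> \<le> 4 * (2 * ((z ^ 2) ^ 2 + (y ^ 2) ^ 2))"
      using *[of "z ^ 2" "y ^ 2"] by linarith
    finally have "(z + y) ^ 4 \<le> 8 * (z ^ 4 + y ^ 4)" by (simp flip: power_mult)
    then show "poly ([:- a, 1:] ^ 4) s \<le> poly (smult 8 (center_poly k ^ 4 + smult (Y a k ^ 4) 1)) s"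
      unfolding c by (simp add: z_def y_def)
  qed
  also have "\<dots> = W a k" by (simp only: W_def mean_add mean_smult mean_center mean_1) simp
  finally show "mean k ([:- a, 1:] ^ 4) \<le> W a k" .
qed

lemma scaled_basis_integral:
  assumes "0 < n"
  shows "(\<lambda>t. jain_basis \<beta> n k t * poly p (real n * t)) absolutely_integrable_on {0..}"
    and "integral {0..} (\<lambda>t. jain_basis \<beta> n k t * poly p (real n * t)) = mean k p * J 0 k / real n"
proof -
  have e: "jain_basis \<beta> n k t * poly p (real n * t)
      = poly (basis_poly k * p) (real n * t) * exp (- (real n * t))" for t
    by (simp add: jain_basis_eq_gen_poisson P_eq_basis_poly)
  note * = absolutely_integrable_scale[OF poly_exp_absolutely_integrable[of "basis_poly k * p"], of "real n"]
  show "(\<lambda>t. jain_basis \<beta> n k t * poly p (real n * t)) absolutely_integrable_on {0..}"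
    unfolding e by (rule *(1)) (use assms in simp)
  show "integral {0..} (\<lambda>t. jain_basis \<beta> n k t * poly p (real n * t)) = mean k p * J 0 k / real n"
    unfolding e using *(2) assms J_0_pos[of k] by (simp add: mean_def laplace_def)
qed

definition durrmeyer_coeff :: "nat \<Rightarrow> (real \<Rightarrow> real) \<Rightarrow> nat \<Rightarrow> real" where
  "durrmeyer_coeff n f k = inverse (LINT t:{0..}|lebesgue. jain_basis \<beta> n k t)
     * (LINT t:{0..}|lebesgue. jain_basis \<beta> n k t * f t)"

text \<open>The pointwise estimate is integrated against the nonnegative basis function and divided
  by its mass \<open>J 0 k / n\<close>. The quartic moment is then replaced by its bound
  \<open>W\<close>, which is where \<open>0 \<le> C\<close> enters.\<close>

lemma durrmeyer_coeff_taylor: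
  assumes n: "0 < n"
    and bdd: "bounded (f ` {0..})" and int: "set_integrable lebesgue {0..} f"
    and approx: "\<And>t. 0 \<le> t \<Longrightarrow> \<bar>f t - c0 - c1 * (t - x) - c2 * (t - x)\<^sup>2\<bar> \<le> e * (t - x)\<^sup>2 + C * (t - x) ^ 4"
    and C: "0 \<le> C"
  defines "a \<equiv> real n * x"
  shows "\<bar>durrmeyer_coeff n f k - c0 - c1 / real n * U a k - c2 / (real n)\<^sup>2 * V a k\<bar>
     \<le> e / (real n)\<^sup>2 * V a k + C / real n ^ 4 * W a k"
proof -
  define N where "N = real n"
  have N: "0 < N" using n by (simp add: N_def)
  let ?w = "jain_basis \<beta> n k"
  have w0: "0 \<le> ?w t" if "0 \<le> t" for t
    using that N P_nonneg[of "N * t"] by (simp add: jain_basis_eq_gen_poisson N_def)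
  have w: "?w absolutely_integrable_on {0..}" "integral {0..} ?w = J 0 k / N"
    using scaled_basis_integral[OF n, of k 1] by (simp_all add: mean_1 N_def)
  \<comment> \<open>The Taylor polynomial in the variable \<open>s = N * t\<close>; the powers of
    \<open>N\<close> come from \<open>t - x = (s - a) / N\<close>.\<close>
  define q where "q = [:c0:] + smult (c1 / N) [:- a, 1:] + smult (c2 / N\<^sup>2) ([:- a, 1:] ^ 2)"
  define q' where "q' = smult (e / N\<^sup>2) ([:- a, 1:] ^ 2) + smult (C / N ^ 4) ([:- a, 1:] ^ 4)"
  have Nt: "N * t - a = N * (t - x)" for t by (simp add: a_def N_def algebra_simps)
  have l: "poly [:- a, 1:] (N * t) = N * (t - x)" for t using Nt[of t] by simp
  have q: "poly q (N * t) = c0 + c1 * (t - x) + c2 * (t - x)\<^sup>2" for t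
    by (simp only: q_def poly_add poly_smult poly_power l) (use N in \<open>simp add: power_mult_distrib\<close>)
  have q': "poly q' (N * t) = e * (t - x)\<^sup>2 + C * (t - x) ^ 4" for t
    by (simp only: q'_def poly_add poly_smult poly_power l) (use N in \<open>simp add: power_mult_distrib\<close>)
  have fm: "f \<in> borel_measurable (lebesgue_on {0..})"
    using absolutely_integrable_measurable[of "{0..}" f] int by auto
  have wf: "(\<lambda>t. ?w t * f t) absolutely_integrable_on {0..}"
    using absolutely_integrable_bounded_measurable_product_real[OF fm _ bdd w(1)] by (simp add: mult.commute)
  note wq = scaled_basis_integral[OF n, of k q, folded N_def]
  note wq' = scaled_basis_integral[OF n, of k q', folded N_def]
  have "\<bar>integral {0..} (\<lambda>t. ?w t * f t - ?w t * poly q (N * t))\<bar> \<le> integral {0..} (\<lambda>t. ?w t * poly q' (N * t))"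
    unfolding real_norm_def[symmetric]
  proof (rule integral_norm_bound_integral)
    show "(\<lambda>t. ?w t * f t - ?w t * poly q (N * t)) integrable_on {0..}"
      by (intro integrable_diff set_lebesgue_integral_eq_integral(1) wf wq)
    show "(\<lambda>t. ?w t * poly q' (N * t)) integrable_on {0..}"
      by (intro set_lebesgue_integral_eq_integral(1) wq')
    fix t :: real assume "t \<in> {0..}"
    then have t: "0 \<le> t" by simp
    have "\<bar>f t - poly q (N * t)\<bar> \<le> poly q' (N * t)"
      unfolding q q' using approx[OF t] by (simp add: algebra_simps)
    from mult_left_mono[OF this w0[OF t]]
    show "norm (?w t * f t - ?w t * poly q (N * t)) \<le> ?w t * poly q' (N * t)"
      using w0[OF t] by (simp add: right_diff_distrib[symmetric] abs_mult)
  qed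
  also have "integral {0..} (\<lambda>t. ?w t * f t - ?w t * poly q (N * t))
      = integral {0..} (\<lambda>t. ?w t * f t) - mean k q * J 0 k / N"
    by (subst integral_diff) (auto intro: set_lebesgue_integral_eq_integral(1) wf wq simp: wq(2))
  also have "integral {0..} (\<lambda>t. ?w t * f t) = durrmeyer_coeff n f k * J 0 k / N"
    unfolding durrmeyer_coeff_def set_lebesgue_integral_eq_integral(2)[OF w(1)]
      set_lebesgue_integral_eq_integral(2)[OF wf] w(2)
    using N J_0_pos[of k] by simp
  also have "durrmeyer_coeff n f k * J 0 k / N - mean k q * J 0 k / N
      = (durrmeyer_coeff n f k - mean k q) * (J 0 k / N)" by (simp only: left_diff_distrib times_divide_eq_right diff_divide_distrib)
  also have "integral {0..} (\<lambda>t. ?w t * poly q' (N * t)) = mean k q' * (J 0 k / N)" by (simp add: wq'(2))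
  finally have scaled: "\<bar>(durrmeyer_coeff n f k - mean k q) * (J 0 k / N)\<bar> \<le> mean k q' * (J 0 k / N)" .
  have JN: "0 < J 0 k / N" using N J_0_pos[of k] by simp
  have "\<bar>durrmeyer_coeff n f k - mean k q\<bar> * (J 0 k / N) \<le> mean k q' * (J 0 k / N)"
    using scaled abs_of_pos[OF JN] by (simp only: abs_mult)
  then have "\<bar>durrmeyer_coeff n f k - mean k q\<bar> \<le> mean k q'"
    using mult_le_cancel_right_pos[OF JN] by blast
  also have "mean k q' = e / N\<^sup>2 * mean k ([:- a, 1:] ^ 2) + C / N ^ 4 * mean k ([:- a, 1:] ^ 4)"
    unfolding q'_def mean_add mean_smult ..
  also have "\<dots> \<le> e / N\<^sup>2 * V a k + C / N ^ 4 * W a k"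
    unfolding mean_shifted(2) using C N by (intro add_left_mono mult_left_mono mean_shifted(3)) auto
  finally have le: "\<bar>durrmeyer_coeff n f k - mean k q\<bar> \<le> e / N\<^sup>2 * V a k + C / N ^ 4 * W a k" .
  have c0: "[:c0:] = smult c0 1" by simp
  have "mean k q = c0 * 1 + c1 / N * U a k + c2 / N\<^sup>2 * V a k"
    unfolding q_def c0 mean_add mean_smult mean_1 mean_shifted(1,2) ..
  then have "durrmeyer_coeff n f k - c0 - c1 / N * U a k - c2 / N\<^sup>2 * V a k = durrmeyer_coeff n f k - mean k q"
    by simp
  then show ?thesis using le unfolding N_def by (simp only:)
qed

lemma poly_bounded_M:
  shows "poly_bounded (M 1)" "poly_bounded (M 2)" "poly_bounded (M 4)"
proof -
  show "poly_bounded (M 1)" by (rule poly_bounded_convergent[OF M_1_tendsto])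
  show "poly_bounded (M 2)"
    using poly_bounded_add[OF poly_bounded_convergent[OF M_2_tendsto] poly_bounded_of_nat]
    by (simp only: diff_add_cancel)
  obtain C where C: "0 \<le> C" "\<And>k. M 4 k \<le> C * (1 + (real k)\<^sup>2)" using M_4_bound by blast
  \<comment> \<open>\<open>M_4_bound\<close> is one-sided; nonnegativity turns it into a bound on
    the absolute value.\<close>
  have "0 \<le> M 4 k" for k
  proof -
    have "mean k 0 \<le> mean k (center_poly k ^ 4)" by (rule mean_mono) simp
    moreover have "mean k 0 = 0" by (simp add: mean_def laplace_def)
    ultimately show ?thesis by (simp add: mean_center)
  qed
  then have M4: "\<bar>M 4 k\<bar> \<le> C * (1 + (real k)\<^sup>2)" for k using C(2)[of k] by simp
  show "poly_bounded (M 4)"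
    by (rule poly_bounded_le[OF _ M4]) (intro poly_bounded_mult poly_bounded_add
        poly_bounded_power poly_bounded_const poly_bounded_of_nat)
qed

lemma poly_bounded_UVW:
  shows "poly_bounded (U a)" "poly_bounded (V a)" "poly_bounded (W a)"
  unfolding U_def[abs_def] V_def[abs_def] W_def[abs_def]
  by (intro poly_bounded_add poly_bounded_mult poly_bounded_power poly_bounded_const poly_bounded_M poly_bounded_Y)+

lemma EP_const: "0 \<le> a \<Longrightarrow> EP a (\<lambda>k. c) = c"
  using EP_cmult[OF poly_bounded_const[of 1], of a c] EP_1[of a] by simp

lemma jain_durrmeyer_taylor:
  assumes n: "0 < n" and x: "0 \<le> x"
    and bdd: "bounded (f ` {0..})" and int: "set_integrable lebesgue {0..} f"
    and approx: "\<And>t. 0 \<le> t \<Longrightarrow> \<bar>f t - c0 - c1 * (t - x) - c2 * (t - x)\<^sup>2\<bar> \<le> e * (t - x)\<^sup>2 + C * (t - x) ^ 4"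
    and C: "0 \<le> C"
  defines "a \<equiv> real n * x"
  shows "\<bar>real n * (jain_durrmeyer \<beta> n f x - c0) - (c1 * EP a (U a) + c2 * (EP a (V a) / real n))\<bar>
     \<le> e * (EP a (V a) / real n) + C * (EP a (W a) / real n ^ 3)"
proof -
  define N where "N = real n"
  have N: "0 < N" using n by (simp add: N_def)
  have a: "0 \<le> a" using x by (simp add: a_def)
  define A where "A = durrmeyer_coeff n f"
  define p1 p2 where "p1 = - c1 / N" and "p2 = - c2 / N\<^sup>2"
  define T where "T = (\<lambda>k. - c0 + (p1 * U a k + p2 * V a k))"
  define B where "B = (\<lambda>k. e / N\<^sup>2 * V a k + C / N ^ 4 * W a k)"
  note pb = poly_bounded_add poly_bounded_mult poly_bounded_const poly_bounded_UVW
  have T: "poly_bounded T" and B: "poly_bounded B" unfolding T_def B_def by (intro pb)+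
  have close: "\<bar>A k + T k\<bar> \<le> B k" for k
    using durrmeyer_coeff_taylor[OF n bdd int approx C, of k] by (simp add: A_def T_def B_def a_def N_def p1_def p2_def)
  \<comment> \<open>This settles convergence of the operator series: \<open>A\<close> differs from a
    sequence bounded by \<open>B\<close> only by \<open>T\<close>, hence has polynomial
    growth.\<close>
  have AT: "poly_bounded (\<lambda>k. A k + T k)" by (rule poly_bounded_le[OF B close])
  have A: "poly_bounded A" using poly_bounded_diff[OF AT T] by simp
  have D: "jain_durrmeyer \<beta> n f x = EP a A"
    unfolding jain_durrmeyer_def EP_def A_def durrmeyer_coeff_def a_def
    by (simp add: jain_basis_eq_gen_poisson mult_ac)
  have ET: "EP a T = - c0 + (p1 * EP a (U a) + p2 * EP a (V a))"
    unfolding T_def by (simp only: EP_add EP_cmult EP_const a pb)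
  have EB: "EP a B = e / N\<^sup>2 * EP a (V a) + C / N ^ 4 * EP a (W a)"
    unfolding B_def by (simp only: EP_add EP_cmult a pb)
  have "EP a A + EP a T \<le> EP a B"
    using EP_mono[OF AT B a] close EP_add[OF A T a] by (simp add: abs_le_iff)
  moreover have "- EP a B \<le> EP a A + EP a T"
  proof -
    have "EP a (\<lambda>k. (-1) * B k) \<le> EP a (\<lambda>k. A k + T k)"
    proof (rule EP_mono[OF _ AT a])
      show "(-1) * B k \<le> A k + T k" for k using close[of k] by simp
    qed (use B in auto)
    then show ?thesis using EP_cmult[OF B a, of "-1"] EP_add[OF A T a] by simp
  qed
  ultimately have "N * \<bar>EP a A + EP a T\<bar> \<le> N * EP a B" using N by (intro mult_left_mono) auto
  moreover have "N * \<bar>EP a A + EP a T\<bar> = \<bar>N * (EP a A + EP a T)\<bar>" using N by (simp add: abs_mult)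
  moreover have "N * (EP a A + EP a T) = N * (EP a A - c0) - (c1 * EP a (U a) + c2 * (EP a (V a) / N))"
    using N by (simp add: ET p1_def p2_def field_simps power2_eq_square)
  moreover have "N * EP a B = e * (EP a (V a) / N) + C * (EP a (W a) / N ^ 3)"
    using N by (simp add: EB field_simps eval_nat_numeral)
  ultimately show ?thesis by (simp add: D N_def)
qed

subsection \<open>Asymptotics of the averaged moments\<close>

lemma EP_abs_le:
  assumes "poly_bounded \<phi>" "poly_bounded \<psi>" "0 \<le> a" "\<And>k. \<bar>\<phi> k\<bar> \<le> \<psi> k"
  shows "\<bar>EP a \<phi>\<bar> \<le> EP a \<psi>"
proof -
  have "EP a \<phi> \<le> EP a \<psi>" using assms(4) by (intro EP_mono assms) (simp add: abs_le_iff)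
  moreover have "(-1) * EP a \<psi> \<le> EP a \<phi>"
    unfolding EP_cmult[OF assms(2,3), symmetric]
  proof (rule EP_mono)
    show "(-1) * \<psi> k \<le> \<phi> k" for k using assms(4)[of k] by simp
    show "poly_bounded (\<lambda>k. (-1) * \<psi> k)" by (intro poly_bounded_mult poly_bounded_const assms)
  qed (use assms in auto)
  ultimately show ?thesis by simp
qed

lemma EP_Y:
  assumes "0 \<le> a"
  shows "EP a (Y a) = 0" and "EP a (\<lambda>k. Y a k ^ 2) = a / (1 - \<beta>)"
  using mP_1[OF assms] mP_2[OF assms] by (simp_all add: mP_def)

lemma EP_of_nat:
  assumes "0 \<le> a"
  shows "EP a real = a / (1 - \<beta>)"
proof -
  have "real = (\<lambda>k. 1 / (1 - \<beta>) * Y a k + a / (1 - \<beta>))"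
    using \<beta>_less_1 by (simp add: fun_eq_iff Y_def add_divide_distrib[symmetric])
  then have "EP a real = EP a (\<lambda>k. 1 / (1 - \<beta>) * Y a k + a / (1 - \<beta>))" by simp
  also have "\<dots> = 1 / (1 - \<beta>) * EP a (Y a) + a / (1 - \<beta>)"
    by (simp only: EP_add EP_cmult EP_const assms poly_bounded_mult poly_bounded_const poly_bounded_Y)
  finally show ?thesis by (simp add: EP_Y assms)
qed

lemma EP_of_nat_power2_le:
  assumes "0 \<le> a"
  shows "EP a (\<lambda>k. (real k)\<^sup>2) \<le> 2 / (1 - \<beta>)\<^sup>2 * (a / (1 - \<beta>) + a\<^sup>2)"
proof -
  have "EP a (\<lambda>k. (real k)\<^sup>2) \<le> EP a (\<lambda>k. 2 / (1 - \<beta>)\<^sup>2 * (Y a k ^ 2 + a\<^sup>2))"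
  proof (rule EP_mono)
    fix k
    have k: "real k = (Y a k + a) / (1 - \<beta>)" using \<beta>_less_1 by (simp add: Y_def)
    have "(Y a k + a)\<^sup>2 \<le> 2 * (Y a k ^ 2 + a\<^sup>2)"
      using sum_squares_bound[of "Y a k" a] by (simp add: power2_sum)
    from divide_right_mono[OF this, of "(1 - \<beta>)\<^sup>2"]
    show "(real k)\<^sup>2 \<le> 2 / (1 - \<beta>)\<^sup>2 * (Y a k ^ 2 + a\<^sup>2)"
      by (subst k) (simp add: power_divide)
  qed (intro poly_bounded_mult poly_bounded_add poly_bounded_power poly_bounded_const
      poly_bounded_of_nat poly_bounded_Y assms)+
  also have "\<dots> = 2 / (1 - \<beta>)\<^sup>2 * (EP a (\<lambda>k. Y a k ^ 2) + a\<^sup>2)"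
    by (simp only: EP_add EP_cmult EP_const assms poly_bounded_add poly_bounded_mult poly_bounded_power poly_bounded_const poly_bounded_Y)
  finally show ?thesis by (simp only: EP_Y assms)
qed

lemma EP_U_eq:
  assumes "0 \<le> a"
  shows "EP a (U a) = EP a (M 1)"
  unfolding U_def[abs_def] by (simp only: EP_add EP_Y assms poly_bounded_M poly_bounded_Y add_0_right)

text \<open>A Toeplitz argument: \<open>M 1 k\<close> converges as \<open>k\<close> grows, and for
  \<open>x > 0\<close> every fixed \<open>k\<close> loses its weight, being dominated by
  \<open>Q\<close>, a constant times \<open>u ^ k * exp (- u)\<close> with
  \<open>u = n x + k \<beta>\<close>.\<close>

lemma EP_U_tendsto:
  assumes x: "0 < x"
  shows "(\<lambda>n. EP (real n * x) (U (real n * x))) \<longlonglongrightarrow> 1 / (1 - \<beta>)"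
proof (rule tendstoI)
  fix e :: real assume e: "0 < e"
  define l where "l = 1 / (1 - \<beta>)"
  have "\<forall>\<^sub>F k in sequentially. dist (M 1 k) l < e / 2"
    unfolding l_def using M_1_tendsto e by (intro tendstoD) auto
  then obtain m where m: "\<And>k. m \<le> k \<Longrightarrow> \<bar>M 1 k - l\<bar> < e / 2"
    unfolding eventually_sequentially dist_real_def by blast
  have P_lim: "(\<lambda>n. P (real n * x) k) \<longlonglongrightarrow> 0" for k
  proof (rule tendsto_sandwich[of "\<lambda>_. 0"])
    have "filterlim (\<lambda>n. real k * \<beta> + x * real n) at_top sequentially"
      using x by (intro filterlim_tendsto_add_at_top[OF tendsto_const]
          filterlim_tendsto_pos_mult_at_top[OF tendsto_const _ filterlim_real_sequentially])
    from filterlim_compose[OF tendsto_power_div_exp_0[of k] this]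
    have "(\<lambda>n. 1 / fact k * ((real k * \<beta> + x * real n) ^ k / exp (real k * \<beta> + x * real n))) \<longlonglongrightarrow> 1 / fact k * 0"
      by (intro tendsto_mult_left)
    then show "(\<lambda>n. Q (real n * x) k) \<longlonglongrightarrow> 0"
      unfolding poisson_weight_def exp_minus by (simp add: divide_inverse mult_ac add_ac)
  qed (use x P_nonneg P_le_Q in auto)
  have "(\<lambda>n. \<Sum>k<m. \<bar>M 1 k - l\<bar> * P (real n * x) k) \<longlonglongrightarrow> (\<Sum>k<m. \<bar>M 1 k - l\<bar> * 0)"
    by (intro tendsto_sum tendsto_mult_left P_lim)
  then have "\<forall>\<^sub>F n in sequentially. (\<Sum>k<m. \<bar>M 1 k - l\<bar> * P (real n * x) k) < e / 2"
    using e by (intro order_tendstoD(2)) auto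
  then show "\<forall>\<^sub>F n in sequentially. dist (EP (real n * x) (U (real n * x))) (1 / (1 - \<beta>)) < e"
  proof eventually_elim
    case (elim n)
    define a where "a = real n * x"
    have a: "0 \<le> a" using x by (simp add: a_def)
    \<comment> \<open>\<open>h\<close> keeps the errors for \<open>k < m\<close>, whose weights
      vanish; the others are below \<open>e / 2\<close>, and so is their average as the total mass
      is 1.\<close>
    define h where "h = (\<lambda>k. if k \<in> {..<m} then \<bar>M 1 k - l\<bar> else 0)"
    have h_sums: "(\<lambda>k. h k * P a k) sums (\<Sum>k<m. \<bar>M 1 k - l\<bar> * P a k)"
      using sums_If_finite_set[of "{..<m}" "\<lambda>k. \<bar>M 1 k - l\<bar> * P a k"]
      by (simp add: h_def if_distrib[of "\<lambda>y. y * _"] cong: if_cong)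
    have pbM: "poly_bounded (\<lambda>k. M 1 k + (- l))"
      by (intro poly_bounded_add poly_bounded_M poly_bounded_const)
    then have "poly_bounded (\<lambda>k. \<bar>M 1 k + (- l)\<bar>)" by (simp add: poly_bounded_def)
    then have pbh: "poly_bounded h" by (rule poly_bounded_le) (simp add: h_def)
    have "EP a (M 1) - l = EP a (\<lambda>k. M 1 k + (- l))"
      by (simp only: EP_add EP_const a poly_bounded_M poly_bounded_const diff_conv_add_uminus)
    also have "\<bar>\<dots>\<bar> \<le> EP a (\<lambda>k. h k + e / 2)"
    proof (rule EP_abs_le[OF pbM _ a])
      show "\<bar>M 1 k + (- l)\<bar> \<le> h k + e / 2" for k
        using m[of k] e by (cases "k < m") (auto simp: h_def)
    qed (intro poly_bounded_add pbh poly_bounded_const)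
    also have "\<dots> = EP a h + e / 2" by (simp only: EP_add EP_const a pbh poly_bounded_const)
    also have "EP a h = (\<Sum>k<m. \<bar>M 1 k - l\<bar> * P a k)" using h_sums by (simp add: EP_def sums_iff)
    finally have "\<bar>EP a (M 1) - l\<bar> < e" using elim by (simp add: a_def)
    then show ?case by (simp add: EP_U_eq[OF a, unfolded a_def] dist_real_def a_def l_def)
  qed
qed

text \<open>Only \<open>k = 0\<close> carries weight, and there \<open>s\<close> is standard
  exponential with mean 1. This value replaces \<open>1 / (1 - \<beta>)\<close> at
  \<open>x = 0\<close> and accounts for the last assumption of the theorem.\<close>

lemma EP_U_0: "EP 0 (U 0) = 1"
proof -
  have "laplace 1 = 1" using laplace_pderiv[of 1] by (simp add: laplace_def)
  then have \<gamma>0: "\<gamma> 0 0 = 1" by (simp add: \<gamma>_def)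
  then have \<gamma>1: "\<gamma> 1 0 = 1" using \<gamma>_rec[of 0 0] by simp
  have \<epsilon>: "\<epsilon> 0 0 = 1" "\<epsilon> 1 0 = 0" by (simp_all add: \<epsilon>_def poisson_weight_def)
  have M: "M 1 0 = 1"
    using J_eq[of 0 0] J_eq[of 1 0] \<gamma>0 \<gamma>1 \<epsilon> unfolding M_def by simp
  have "EP 0 (M 1) = (\<Sum>k. if k \<in> {0} then M 1 k else 0)"
    unfolding EP_def P_at_0 by (rule suminf_cong) auto
  also have "\<dots> = 1" using sums_If_finite_set[of "{0::nat}" "M 1"] M by (simp add: sums_iff)
  finally show ?thesis by (simp add: EP_U_eq)
qed

text \<open>The part \<open>k + Y a k ^ 2\<close> averages to exactly
  \<open>2 * a / (1 - \<beta>)\<close>. In the rest, \<open>M 2 k - k\<close> is bounded, and the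
  cross term is of order \<open>sqrt n\<close> because \<open>M 1\<close> is bounded and
  \<open>Y\<close> has variance of order \<open>n\<close>.\<close>

lemma EP_V_tendsto:
  assumes x: "0 \<le> x"
  shows "(\<lambda>n. EP (real n * x) (V (real n * x)) / real n) \<longlonglongrightarrow> 2 * x / (1 - \<beta>)"
proof -
  obtain G1 where G1: "\<And>k. \<bar>M 1 k\<bar> \<le> G1" using tendsto_imp_abs_bounded[OF M_1_tendsto] by blast
  obtain G2 where G2: "\<And>k. \<bar>M 2 k - real k\<bar> \<le> G2" using tendsto_imp_abs_bounded[OF M_2_tendsto] by blast
  have G10: "0 \<le> G1" using G1[of 0] by linarith
  have le: "\<bar>EP (real n * x) (V (real n * x)) / real n - 2 * x / (1 - \<beta>)\<bar>
      \<le> G2 * (1 / real n) + G1 * (x / (1 - \<beta>) + 1) * (1 / sqrt (real n))" if n: "0 < n" for n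
  proof -
    define N where "N = real n"
    define a where "a = N * x"
    have N: "0 < N" using n by (simp add: N_def)
    have a: "0 \<le> a" using N x by (simp add: a_def)
    \<comment> \<open>The weight in \<open>2 * \<bar>Y\<bar> \<le> Y ^ 2 / q + q\<close>, chosen to
      balance both summands when \<open>Y ^ 2\<close> is of order \<open>N\<close>; this takes the
      place of Cauchy-Schwarz.\<close>
    define q where "q = sqrt N"
    have q: "0 < q" "q * q = N" using N by (auto simp: q_def)
    define R where "R = (\<lambda>k. (M 2 k - real k) + 2 * (Y a k * M 1 k))"
    note pb = poly_bounded_add poly_bounded_mult poly_bounded_const poly_bounded_M poly_bounded_of_nat
      poly_bounded_power poly_bounded_Y
    have pbR: "poly_bounded R" unfolding R_def by (intro pb poly_bounded_diff)
    have "V a = (\<lambda>k. R k + (real k + Y a k ^ 2))" by (simp add: fun_eq_iff V_def R_def)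
    then have "EP a (V a) = EP a (\<lambda>k. R k + (real k + Y a k ^ 2))" by simp
    also have "\<dots> = EP a R + (EP a real + EP a (\<lambda>k. Y a k ^ 2))"
      by (simp only: EP_add a pbR pb)
    finally have "EP a (V a) - 2 * (a / (1 - \<beta>)) = EP a R" by (simp only: EP_of_nat EP_Y a)
    also have "\<bar>\<dots>\<bar> \<le> EP a (\<lambda>k. G2 + (G1 / q * Y a k ^ 2 + G1 * q))"
    proof (rule EP_abs_le[OF pbR _ a])
      fix k
      have "2 * \<bar>Y a k\<bar> \<le> Y a k ^ 2 / q + q"
      proof -
        have "0 \<le> (\<bar>Y a k\<bar> - q)\<^sup>2" by simp
        then have "2 * \<bar>Y a k\<bar> * q \<le> Y a k ^ 2 + q * q" by (simp add: power2_eq_square algebra_simps)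
        then have "2 * \<bar>Y a k\<bar> \<le> (Y a k ^ 2 + q * q) / q" using q(1) by (simp add: pos_le_divide_eq)
        then show ?thesis using q(1) by (simp add: add_divide_distrib)
      qed
      then have "\<bar>M 1 k\<bar> * (2 * \<bar>Y a k\<bar>) \<le> G1 * (Y a k ^ 2 / q + q)"
        using G1[of k] G10 by (intro mult_mono) auto
      then have "\<bar>2 * (Y a k * M 1 k)\<bar> \<le> G1 / q * Y a k ^ 2 + G1 * q"
        by (simp add: abs_mult mult_ac distrib_left)
      then show "\<bar>R k\<bar> \<le> G2 + (G1 / q * Y a k ^ 2 + G1 * q)"
        using G2[of k] unfolding R_def by linarith
    qed (intro pb)
    also have "\<dots> = G2 + (G1 / q * (a / (1 - \<beta>)) + G1 * q)"
      by (simp only: EP_add EP_cmult EP_const EP_Y a pb)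
    finally have "\<bar>EP a (V a) - 2 * (a / (1 - \<beta>))\<bar> / N \<le> (G2 + (G1 / q * (a / (1 - \<beta>)) + G1 * q)) / N"
      using N by (intro divide_right_mono) auto
    moreover have "\<bar>EP a (V a) - 2 * (a / (1 - \<beta>))\<bar> / N = \<bar>EP a (V a) / N - 2 * x / (1 - \<beta>)\<bar>"
    proof -
      have "EP a (V a) / N - 2 * x / (1 - \<beta>) = (EP a (V a) - 2 * (a / (1 - \<beta>))) / N"
        using N by (simp add: a_def diff_divide_distrib)
      then show ?thesis using N by (simp only: abs_divide abs_of_pos)
    qed
    moreover have "(G2 + (G1 / q * (a / (1 - \<beta>)) + G1 * q)) / N
        = G2 * (1 / N) + G1 * (x / (1 - \<beta>) + 1) * (1 / q)"
    proof -
      have "G1 / q * (a / (1 - \<beta>)) / N = G1 * (x / (1 - \<beta>)) * (1 / q)" using N by (simp add: a_def)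
      moreover have "G1 * q / N = G1 * (1 / q)" unfolding q(2)[symmetric] using q(1) by simp
      ultimately show ?thesis by (simp only: add_divide_distrib distrib_left distrib_right mult_1_right) simp
    qed
    ultimately show ?thesis unfolding a_def N_def q_def by (simp only:)
  qed
  have "(\<lambda>n. G2 * (1 / real n) + G1 * (x / (1 - \<beta>) + 1) * (1 / sqrt (real n)))
      \<longlonglongrightarrow> G2 * 0 + G1 * (x / (1 - \<beta>) + 1) * 0"
    by (intro tendsto_add tendsto_mult_left inverse_sqrt_tendsto_0 lim_1_over_n)
  then have lim: "(\<lambda>n. G2 * (1 / real n) + G1 * (x / (1 - \<beta>) + 1) * (1 / sqrt (real n))) \<longlonglongrightarrow> 0" by simp
  have "(\<lambda>n. EP (real n * x) (V (real n * x)) / real n - 2 * x / (1 - \<beta>)) \<longlonglongrightarrow> 0"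
    by (rule Lim_null_comparison[OF _ lim])
       (use le in \<open>auto simp: eventually_sequentially intro!: exI[of _ 1]\<close>)
  then show ?thesis by (simp only: LIM_zero_iff)
qed

text \<open>Both parts of \<open>W\<close> average to at most order \<open>n ^ 2\<close>:
  \<open>M 4 k\<close> is bounded by a multiple of \<open>1 + k ^ 2\<close>, and the average of
  \<open>Y ^ 4\<close> is controlled by \<open>mP_4\<close>.\<close>

lemma EP_W_tendsto:
  assumes x: "0 \<le> x"
  shows "(\<lambda>n. EP (real n * x) (W (real n * x)) / real n ^ 3) \<longlonglongrightarrow> 0"
proof -
  obtain C where C: "0 \<le> C" "\<And>k. M 4 k \<le> C * (1 + (real k)\<^sup>2)" using M_4_bound by blast
  obtain c where c: "0 \<le> c" "\<And>a. 0 \<le> a \<Longrightarrow> mP 4 a \<le> c * (1 + a\<^sup>2)" using mP_4 by blast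
  define b where "b = 2 / (1 - \<beta>)\<^sup>2"
  have b: "0 \<le> b" by (simp add: b_def)
  define K where "K = 8 * (C * (1 + b * (x / (1 - \<beta>) + x\<^sup>2)) + c * (1 + x\<^sup>2))"
  have le: "\<bar>EP (real n * x) (W (real n * x)) / real n ^ 3\<bar> \<le> K * (1 / real n)" if n: "0 < n" for n
  proof -
    define N where "N = real n"
    define a where "a = N * x"
    have N: "1 \<le> N" using n by (simp add: N_def)
    have a: "0 \<le> a" using N x by (simp add: a_def)
    note pb = poly_bounded_add poly_bounded_mult poly_bounded_const poly_bounded_M poly_bounded_of_nat
      poly_bounded_power poly_bounded_Y
    have "EP a (W a) \<le> EP a (\<lambda>k. 8 * (C * (1 + (real k)\<^sup>2) + Y a k ^ 4))"
      unfolding W_def by (rule EP_mono) (intro pb a mult_left_mono add_right_mono C; simp)+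
    also have "\<dots> = 8 * (C * (1 + EP a (\<lambda>k. (real k)\<^sup>2)) + mP 4 a)"
      unfolding mP_def by (simp only: EP_add EP_cmult EP_const a pb)
    also have "\<dots> \<le> 8 * (C * (1 + b * (a / (1 - \<beta>) + a\<^sup>2)) + c * (1 + a\<^sup>2))"
      using EP_of_nat_power2_le[OF a] C(1) c(2)[OF a]
      by (intro mult_left_mono add_mono) (auto simp: b_def)
    also have "\<dots> \<le> K * N\<^sup>2"
    proof -
      have N2: "1 \<le> N\<^sup>2" "N \<le> N\<^sup>2" using N self_le_power[of N 2] by (auto intro: one_le_power)
      have a1: "a / (1 - \<beta>) \<le> x / (1 - \<beta>) * N\<^sup>2"
        using mult_right_mono[OF N2(2), of "x / (1 - \<beta>)"] x \<beta>_less_1 by (simp add: a_def mult_ac)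
      have a2: "a\<^sup>2 = x\<^sup>2 * N\<^sup>2" by (simp add: a_def power_mult_distrib)
      have "b * (a / (1 - \<beta>) + a\<^sup>2) \<le> b * ((x / (1 - \<beta>) + x\<^sup>2) * N\<^sup>2)"
        using a1 b by (intro mult_left_mono) (auto simp: a2 distrib_right)
      then have "1 + b * (a / (1 - \<beta>) + a\<^sup>2) \<le> (1 + b * (x / (1 - \<beta>) + x\<^sup>2)) * N\<^sup>2"
        using N2(1) unfolding distrib_right[of 1] by simp
      then have "C * (1 + b * (a / (1 - \<beta>) + a\<^sup>2)) \<le> C * ((1 + b * (x / (1 - \<beta>) + x\<^sup>2)) * N\<^sup>2)"
        using C(1) by (intro mult_left_mono)
      moreover have "c * (1 + a\<^sup>2) \<le> c * ((1 + x\<^sup>2) * N\<^sup>2)"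
        using N2(1) c(1) by (intro mult_left_mono) (auto simp: a2 distrib_right)
      moreover have "K * N\<^sup>2 = 8 * (C * ((1 + b * (x / (1 - \<beta>) + x\<^sup>2)) * N\<^sup>2) + c * ((1 + x\<^sup>2) * N\<^sup>2))"
        unfolding K_def by (simp only: distrib_right mult.assoc)
      ultimately show ?thesis by (simp only: add_mono mult_le_cancel_left_pos zero_less_numeral)
    qed
    finally have up: "EP a (W a) \<le> K * N\<^sup>2" .
    \<comment> \<open>The absolute value also needs a lower bound; \<open>W\<close> dominates the
      mean of a fourth power.\<close>
    have "0 \<le> W a k" for k
    proof -
      have "mean k 0 \<le> mean k ([:- a, 1:] ^ 4)" by (rule mean_mono) simp
      also have "\<dots> \<le> W a k" by (rule mean_shifted)
      finally show ?thesis by (simp add: mean_def laplace_def)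
    qed
    then have "0 \<le> EP a (W a)"
      using EP_mono[of "\<lambda>k. 0" "W a" a] EP_const[OF a, of 0] a poly_bounded_UVW by simp
    then have "\<bar>EP a (W a) / N ^ 3\<bar> = EP a (W a) / N ^ 3" using N by simp
    also have "\<dots> \<le> K * N\<^sup>2 / N ^ 3" using up N by (intro divide_right_mono) auto
    also have "\<dots> = K * (1 / N)" using N by (simp add: power2_eq_square power3_eq_cube)
    finally show ?thesis unfolding a_def N_def .
  qed
  have "(\<lambda>n. K * (1 / real n)) \<longlonglongrightarrow> K * 0" by (intro tendsto_mult_left lim_1_over_n)
  then have lim: "(\<lambda>n. K * (1 / real n)) \<longlonglongrightarrow> 0" by simp
  show ?thesis
    by (rule Lim_null_comparison[OF _ lim])
       (use le in \<open>auto simp: eventually_sequentially intro!: exI[of _ 1]\<close>)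
qed

end

theorem theorem1:
  fixes \<beta> x f'' :: real and f f' :: "real \<Rightarrow> real"
  assumes "0 \<le> \<beta>" and "\<beta> < 1"
    and "bounded (f ` {0..})"
    and "set_integrable lebesgue {0..} f"
    and "0 \<le> x"
    and "\<forall>\<^sub>F y in nhds x. 0 \<le> y \<longrightarrow> (f has_real_derivative f' y) (at y within {0..})"
    and "(f' has_real_derivative f'') (at x within {0..})"
    and "x = 0 \<Longrightarrow> \<beta> = 0 \<or> f' 0 = 0"
  shows "(\<lambda>n. real n * (jain_durrmeyer \<beta> n f x - f x))
           \<longlonglongrightarrow> 1 / (1 - \<beta>) * f' x + x / (1 - \<beta>) * f''"
proof -
  interpret jain \<beta> by unfold_locales (fact assms(1,2))+
  let ?U = "\<lambda>n. EP (real n * x) (U (real n * x))"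
  let ?V = "\<lambda>n. EP (real n * x) (V (real n * x)) / real n"
  let ?W = "\<lambda>n. EP (real n * x) (W (real n * x)) / real n ^ 3"
  have U: "(\<lambda>n. f' x * ?U n) \<longlonglongrightarrow> 1 / (1 - \<beta>) * f' x"
  proof (cases "x = 0")
    case True
    \<comment> \<open>Here \<open>?U n\<close> is constantly 1, and the assumption for
      \<open>x = 0\<close> reconciles this with the factor \<open>1 / (1 - \<beta>)\<close>.\<close>
    then have "1 / (1 - \<beta>) * f' x = f' x * 1" using assms(8) by auto
    then show ?thesis by (simp add: True EP_U_0)
  next
    case False
    then have "(\<lambda>n. f' x * ?U n) \<longlonglongrightarrow> f' x * (1 / (1 - \<beta>))"
      using assms(5) by (intro tendsto_mult_left EP_U_tendsto) simp
    then show ?thesis by (simp only: mult.commute)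
  qed
  have "(\<lambda>n. f'' / 2 * ?V n) \<longlonglongrightarrow> f'' / 2 * (2 * x / (1 - \<beta>))"
    by (intro tendsto_mult_left EP_V_tendsto assms)
  also have "f'' / 2 * (2 * x / (1 - \<beta>)) = x / (1 - \<beta>) * f''" by simp
  finally have Z: "(\<lambda>n. f' x * ?U n + f'' / 2 * ?V n) \<longlonglongrightarrow> 1 / (1 - \<beta>) * f' x + x / (1 - \<beta>) * f''"
    using U by (intro tendsto_add)
  show ?thesis
  \<comment> \<open>The Taylor error splits into \<open>e\<close> times the convergent
    \<open>?V\<close> and \<open>C\<close> times \<open>?W\<close>, which tends to 0.\<close>
  proof (rule tendsto_if_epsilon_close[OF _ EP_V_tendsto[OF assms(5)] EP_W_tendsto[OF assms(5)] Z])
    fix e :: real assume "0 < e"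
    from taylor_2_global_bound[OF assms(3,5,6,7) this] obtain C where C: "0 \<le> C"
      "\<And>t. 0 \<le> t \<Longrightarrow> \<bar>f t - f x - f' x * (t - x) - f'' / 2 * (t - x)\<^sup>2\<bar> \<le> e * (t - x)\<^sup>2 + C * (t - x) ^ 4"
      by blast
    show "\<exists>C. \<forall>n>0. \<bar>real n * (jain_durrmeyer \<beta> n f x - f x) - (f' x * ?U n + f'' / 2 * ?V n)\<bar>
        \<le> e * ?V n + C * ?W n"
      using jain_durrmeyer_taylor[OF _ assms(5,3,4) C(2,1)] by blast
  qed
qed

end
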